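(* Let $n\ge 1$. The nerve $N_n:=N(\mathcal C_n)$ of the family $\mathcal C_n$ of all distinct full star- and full top-simplices has the homotopy type of a CW-complex of dimension at most $2$.
   Context: A partition of $n$ is a weakly decreasing sequence $\lambda=(\lambda_1\ge\cdots\ge\lambda_\ell>0)$ of positive integers with sum $n$, identified with its Ferrers diagram ($\lambda_i$ left-justified cells in row $i$); set $\lambda_{\ell+1}=0$. A removable corner of $\lambda$ is the last cell of a row whose length is strictly greater than that of the next row; an addable corner is a position where a cell can be added so that the result is again a Ferrers diagram of a partition (row $\ell+1$ allowed). Write $r(\cdot)$ for the row number of a corner. For a removable corner $c$ and an addable corner $a$ of $\lambda$ with $r(c)\ne r(a)$, remove $c$ (decrease $\lambda_{r(c)}$ by $1$), add a cell at $a$ (increase $\lambda_{r(a)}$ by $1$), and reorder row lengths into weakly decreasing order. If the result is a partition of $n$ different from $\lambda$, the transfer is called admissible and the result is denoted $\lambda(c\to a)$. For a removable corner $c$ of $\lambda$, the full star-simplex is $\Sigma^{\mathrm{star}}_{\max}(\lambda,c):=\{\lambda\}\cup\{\lambda(c\to a):a \text{ with } \lambda(c\to a)\text{ admissible}\}$. For an addable corner $a$ of $\lambda$, the full top-simplex is $\Sigma^{\mathrm{top}}_{\max}(\lambda,a):=\{\lambda\}\cup\{\lambda(c\to a):c\text{ with }\lambda(c\to a)\text{ admissible}\}$. $\mathcal C_n$ is the set of all full star- and full top-simplices over all partitions $\lambda$ of $n$ and all their corners, with equal sets identified. The nerve $N_n=N(\mathcal C_n)$ is the simplicial complex with vertex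 set $\mathcal C_n$ in which $\{U_0,\dots,U_p\}\subseteq\mathcal C_n$ is a simplex if and only if $U_0\cap\cdots\cap U_p\ne\varnothing$. *)

theory Defs
  imports "HOL-Analysis.Analysis"
begin

section \<open>Partitions and transfers\<close>

text \<open>A partition is the list of its row lengths. Rows are numbered from 0; rows beyond the
  last one have length 0.\<close>

definition is_partition :: "nat \<Rightarrow> nat list \<Rightarrow> bool" where
  "is_partition n l \<longleftrightarrow> sorted_wrt (\<ge>) l \<and> (\<forall>x\<in>set l. 0 < x) \<and> sum_list l = n"

definition row :: "nat list \<Rightarrow> nat \<Rightarrow> nat" where
  "row l i = (if i < length l then l ! i else 0)"

text \<open>Each row contains at most one corner of either kind, so a corner is given by its row number.
  The new row of index \<open>length l\<close> is included among the addable corners.\<close>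

definition removable :: "nat list \<Rightarrow> nat set" where
  "removable l = {c. row l (Suc c) < row l c}"

definition addable :: "nat list \<Rightarrow> nat set" where
  "addable l = {a. antimono ((row l)(a := row l a + 1))}"

text \<open>Rows that have become empty are dropped.\<close>

definition transfer :: "nat list \<Rightarrow> nat \<Rightarrow> nat \<Rightarrow> nat list" where
  "transfer l c a =
     rev (sort (filter (\<lambda>x. 0 < x)
       (map ((row l)(c := row l c - 1, a := row l a + 1)) [0..<Suc (length l)])))"

definition admissible :: "nat \<Rightarrow> nat list \<Rightarrow> nat \<Rightarrow> nat \<Rightarrow> bool" where
  "admissible n l c a \<longleftrightarrow>
     c \<in> removable l \<and> a \<in> addable l \<and> c \<noteq> a \<and>
     is_partition n (transfer l c a) \<and> transfer l c a \<noteq> l"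

definition star_simplex :: "nat \<Rightarrow> nat list \<Rightarrow> nat \<Rightarrow> nat list set" where
  "star_simplex n l c = insert l {transfer l c a |a. admissible n l c a}"

definition top_simplex :: "nat \<Rightarrow> nat list \<Rightarrow> nat \<Rightarrow> nat list set" where
  "top_simplex n l a = insert l {transfer l c a |c. admissible n l c a}"

definition full_simplices :: "nat \<Rightarrow> nat list set set" where
  "full_simplices n =
     {star_simplex n l c |l c. is_partition n l \<and> c \<in> removable l} \<union>
     {top_simplex n l a |l a. is_partition n l \<and> a \<in> addable l}"


section \<open>Nerve and geometric realization\<close>

text \<open>An abstract simplicial complex is given by its set of nonempty simplices.\<close>

definition nerve :: "'a set set \<Rightarrow> 'a set set set" where
  "nerve F = {S. S \<subseteq> F \<and> finite S \<and> S \<noteq> {} \<and> \<Inter>S \<noteq> {}}"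

text \<open>Barycentric coordinates, with the topology of pointwise convergence. For a complex with
  finitely many vertices, such as the nerve of \<open>full_simplices n\<close>, this is the usual
  (Euclidean, equivalently coherent) topology.\<close>

definition realization :: "'v set set \<Rightarrow> ('v \<Rightarrow> real) topology" where
  "realization K = top_of_set
     {\<alpha>. (\<forall>v. 0 \<le> \<alpha> v) \<and> {v. \<alpha> v \<noteq> 0} \<in> K \<and> (\<Sum>v | \<alpha> v \<noteq> 0. \<alpha> v) = 1}"


section \<open>CW-complexes\<close>

definition closed_disc :: "nat \<Rightarrow> (nat \<Rightarrow> real) topology" where
  "closed_disc k = subtopology (Euclidean_space k) {x. (\<Sum>i<k. (x i)\<^sup>2) \<le> 1}"

definition disc_interior :: "nat \<Rightarrow> (nat \<Rightarrow> real) set" where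
  "disc_interior k = {x \<in> topspace (closed_disc k). (\<Sum>i<k. (x i)\<^sup>2) < 1}"

definition disc_boundary :: "nat \<Rightarrow> (nat \<Rightarrow> real) set" where
  "disc_boundary k = {x \<in> topspace (closed_disc k). (\<Sum>i<k. (x i)\<^sup>2) = 1}"

text \<open>Whitehead's definition: \<open>E\<close> is the set of open cells, \<open>d\<close> gives their dimensions and \<open>\<Phi>\<close>
  their characteristic maps. The sixth condition is closure-finiteness together with the
  requirement that boundaries lie in cells of lower dimension; the last one says that \<open>X\<close> has
  the weak topology with respect to the closed cells.\<close>

definition CW_structure ::
  "'a topology \<Rightarrow> 'a set set \<Rightarrow> ('a set \<Rightarrow> nat) \<Rightarrow> ('a set \<Rightarrow> (nat \<Rightarrow> real) \<Rightarrow> 'a) \<Rightarrow> bool" where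
  "CW_structure X E d \<Phi> \<longleftrightarrow>
     Hausdorff_space X \<and>
     pairwise disjnt E \<and> \<Union>E = topspace X \<and>
     (\<forall>e\<in>E. continuous_map (closed_disc (d e)) X (\<Phi> e)) \<and>
     (\<forall>e\<in>E. homeomorphic_map (subtopology (closed_disc (d e)) (disc_interior (d e)))
               (subtopology X e) (\<Phi> e)) \<and>
     (\<forall>e\<in>E. \<exists>F. finite F \<and> F \<subseteq> {e'\<in>E. d e' < d e} \<and> \<Phi> e ` disc_boundary (d e) \<subseteq> \<Union>F) \<and>
     (\<forall>A. A \<subseteq> topspace X \<longrightarrow>
        (closedin X A \<longleftrightarrow> (\<forall>e\<in>E. closedin X (A \<inter> \<Phi> e ` topspace (closed_disc (d e))))))"

definition CW_complex_dim_le :: "nat \<Rightarrow> 'a topology \<Rightarrow> bool" where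
  "CW_complex_dim_le k X \<longleftrightarrow> (\<exists>E d \<Phi>. CW_structure X E d \<Phi> \<and> (\<forall>e\<in>E. d e \<le> k))"

end

theory Submission
  imports Defs
begin

text \<open>A star-simplex consists of all partitions of \<open>n\<close> covering a fixed partition \<open>\<mu>\<close> of \<open>n - 1\<close>, and
  a top-simplex of all partitions of \<open>n\<close> covered by a fixed partition \<open>\<nu>\<close> of \<open>n + 1\<close>. Two distinct
  common members \<open>x\<close>, \<open>y\<close> force \<open>\<mu> = x \<inter> y\<close>, respectively \<open>\<nu> = x \<union> y\<close>. The nerve is the union of
  the full simplices \<open>A\<^sub>x\<close> spanned by the members of the family that contain \<open>x\<close>, so two of these
  meet in at most one edge. Hence each \<open>A\<^sub>x\<close> may be replaced by the cone over its 1-skeleton,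
  without changing the homotopy type; the result has dimension at most 2.\<close>

text \<open>The homotopy equivalence is given by formulas in barycentric coordinates, not by gluing
  facet by facet. The key quantity is the third largest coordinate of a point on a facet: it is
  continuous, and it vanishes on every face with at most two vertices, hence wherever another facet
  meets this one. Cutting all coordinates of the facet down by that value leaves at most two of them
  nonzero, and the mass cut off goes to the apex. The sum of these corrections over all facets is a
  single formula, continuous without a case distinction, which on each facet sees only the
  correction of that facet. A second obstacle is the reordering inside a transfer. It has an effect
  only if a cell moves down one row and the two rows thereby exchange their lengths; then the
  original partition comes back. So admissible transfers never need reordering, and the full
  simplices become sets of covers.\<close>

lemma continuous_on_coordinate: "continuous_on S (\<lambda>x::'a \<Rightarrow> real. x i)"
  by (rule continuous_on_subset[OF continuous_on_product_coordinates]) simp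

lemma continuous_on_Max_image:
  fixes f :: "'i \<Rightarrow> 'a::topological_space \<Rightarrow> real"
  assumes "finite I" "I \<noteq> {}" "\<And>i. i \<in> I \<Longrightarrow> continuous_on S (f i)"
  shows "continuous_on S (\<lambda>x. Max ((\<lambda>i. f i x) ` I))"
  using assms
proof (induction I rule: finite_ne_induct)
  case (insert i I)
  then show ?case by (simp add: continuous_on_max)
qed simp

lemma continuous_on_Min_image:
  fixes f :: "'i \<Rightarrow> 'a::topological_space \<Rightarrow> real"
  assumes "finite I" "I \<noteq> {}" "\<And>i. i \<in> I \<Longrightarrow> continuous_on S (f i)"
  shows "continuous_on S (\<lambda>x. Min ((\<lambda>i. f i x) ` I))"
  using assms
proof (induction I rule: finite_ne_induct)
  case (insert i I)
  then show ?case by (simp add: continuous_on_min)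
qed simp

section \<open>Finite simplicial complexes are CW-complexes\<close>

lemma topspace_closed_disc:
  "topspace (closed_disc k) = {x. (\<forall>i\<ge>k. x i = 0) \<and> (\<Sum>i<k. (x i)\<^sup>2) \<le> 1}"
  by (auto simp: closed_disc_def topspace_Euclidean_space)

lemma closed_disc_eq: "closed_disc k = top_of_set (topspace (closed_disc k))"
  unfolding topspace_closed_disc
  by (auto simp: closed_disc_def Euclidean_space_def euclidean_product_topology
      subtopology_subtopology intro!: arg_cong[of _ _ top_of_set])

text \<open>The ball is closed in a Tychonoff product of intervals [-1, 1]. Compactness later makes
  the characteristic maps closed.\<close>

lemma compact_space_closed_disc: "compact_space (closed_disc k)"
proof -
  let ?D = "topspace (closed_disc k)"
  have "compactin (powertop_real UNIV) (PiE UNIV (\<lambda>_::nat. {-1..1::real}))"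
    by (subst compactin_PiE) simp
  moreover have "?D \<subseteq> PiE UNIV (\<lambda>_::nat. {-1..1::real})"
  proof
    fix x assume x: "x \<in> ?D"
    have "\<bar>x i\<bar> \<le> 1" for i
    proof (cases "i < k")
      case True
      then have "(x i)\<^sup>2 \<le> (\<Sum>i<k. (x i)\<^sup>2)"
        by (intro member_le_sum) auto
      also have "\<dots> \<le> 1" using x by (simp add: topspace_closed_disc)
      finally show ?thesis by (simp add: abs_square_le_1)
    qed (use x in \<open>simp add: topspace_closed_disc\<close>)
    then show "x \<in> PiE UNIV (\<lambda>_::nat. {-1..1::real})"
      by (auto simp: abs_le_iff minus_le_iff)
  qed
  moreover have "closed ?D"
    unfolding topspace_closed_disc
    by (intro closed_Collect_conj closed_Collect_all closed_Collect_imp closed_Collect_eq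
        closed_Collect_le continuous_intros continuous_on_coordinate) simp_all
  ultimately have "compactin euclidean ?D"
    by (metis closed_compactin closed_closedin euclidean_product_topology)
  then show ?thesis
    by (metis closed_disc_eq compact_space_subtopology)
qed

section \<open>A map from the ball to the simplex, bijective between the interiors\<close>

definition simplex_direction :: "nat \<Rightarrow> (nat \<Rightarrow> real) \<Rightarrow> nat \<Rightarrow> real" where
  "simplex_direction k x i = (if i < k then x i else - (\<Sum>j<k. x j))"

text \<open>In the hyperplane of coordinate sum 0, this is the Minkowski gauge of the simplex whose
  points have all entries at least -1, that is, of the standard simplex moved to have barycentre 0
  and enlarged by the factor \<open>k + 1\<close>.\<close>

definition simplex_gauge :: "nat \<Rightarrow> (nat \<Rightarrow> real) \<Rightarrow> real" where
  "simplex_gauge k x = Max ((\<lambda>i. - simplex_direction k x i) ` {..k})"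

text \<open>The ball is identified with the hyperplane of coordinate sum 0 by
  \<^const>\<open>simplex_direction\<close>, and each ray is rescaled so that the boundary of the ball goes to the
  boundary of the simplex centred at its barycentre. At the origin the quotient is \<open>0 / 0 = 0\<close>,
  which is the intended value.\<close>

definition disc_to_simplex :: "nat \<Rightarrow> (nat \<Rightarrow> real) \<Rightarrow> nat \<Rightarrow> real" where
  "disc_to_simplex k x i =
     (1 + simplex_direction k x i * L2_set x {..<k} / simplex_gauge k x) / (k + 1)"

lemma sum_simplex_direction: "(\<Sum>i\<le>k. simplex_direction k x i) = 0"
proof -
  have "(\<Sum>i\<le>k. simplex_direction k x i) = (\<Sum>i<k. simplex_direction k x i) + simplex_direction k x k"
    by (simp flip: lessThan_Suc_atMost)
  also have "(\<Sum>i<k. simplex_direction k x i) = (\<Sum>i<k. x i)"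
    by (intro sum.cong) (auto simp: simplex_direction_def)
  finally show ?thesis by (simp add: simplex_direction_def)
qed

lemma neg_simplex_direction_le_gauge:
  "i \<le> k \<Longrightarrow> - simplex_direction k x i \<le> simplex_gauge k x"
  by (auto simp: simplex_gauge_def intro!: Max_ge)

lemma simplex_gauge_attained:
  obtains i where "i \<le> k" "simplex_gauge k x = - simplex_direction k x i"
proof -
  have "simplex_gauge k x \<in> (\<lambda>i. - simplex_direction k x i) ` {..k}"
    unfolding simplex_gauge_def by (intro Max_in) auto
  then show ?thesis using that by auto
qed

text \<open>As the entries sum to 0, a positive entry is balanced by the \<open>k\<close> others,
  none of which is below minus the gauge.\<close>

lemma simplex_direction_le:
  assumes "i \<le> k"
  shows "simplex_direction k x i \<le> k * simplex_gauge k x"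
proof -
  have "(\<Sum>j\<le>k. simplex_direction k x j)
      = simplex_direction k x i + (\<Sum>j\<in>{..k}-{i}. simplex_direction k x j)"
    using assms by (intro sum.remove) auto
  then have "simplex_direction k x i = (\<Sum>j\<in>{..k}-{i}. - simplex_direction k x j)"
    by (simp add: sum_simplex_direction sum_negf)
  also have "\<dots> \<le> (\<Sum>j\<in>{..k}-{i}. simplex_gauge k x)"
    by (intro sum_mono neg_simplex_direction_le_gauge) auto
  also have "\<dots> = k * simplex_gauge k x"
    using assms by (simp add: card_Diff_singleton)
  finally show ?thesis .
qed

lemma simplex_gauge_nonneg: "0 \<le> simplex_gauge k x"
proof (rule ccontr)
  assume "\<not> 0 \<le> simplex_gauge k x"
  then have "0 < simplex_direction k x i" if "i \<le> k" for i
    using neg_simplex_direction_le_gauge[OF that, of x] by linarith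
  then have "0 < (\<Sum>i\<le>k. simplex_direction k x i)"
    by (intro sum_pos) auto
  then show False by (simp add: sum_simplex_direction)
qed

lemma simplex_gauge_eq_0_iff: "simplex_gauge k x = 0 \<longleftrightarrow> (\<forall>i<k. x i = 0)"
proof
  assume "simplex_gauge k x = 0"
  then have "simplex_direction k x i = 0" if "i \<le> k" for i
    using simplex_direction_le[OF that, of x] neg_simplex_direction_le_gauge[OF that, of x]
    by simp
  then show "\<forall>i<k. x i = 0"
    by (metis less_imp_le simplex_direction_def)
next
  assume "\<forall>i<k. x i = 0"
  then have "simplex_direction k x i = 0" for i
    by (simp add: simplex_direction_def)
  then show "simplex_gauge k x = 0"
    by (metis simplex_gauge_attained neg_0_equal_iff_equal)
qed

lemma continuous_on_simplex_direction: "continuous_on S (\<lambda>x. simplex_direction k x i)"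
  unfolding simplex_direction_def
  by (cases "i < k") (auto intro!: continuous_intros continuous_on_coordinate)

lemma continuous_on_simplex_gauge: "continuous_on S (simplex_gauge k)"
  unfolding simplex_gauge_def
  by (intro continuous_on_Max_image continuous_intros continuous_on_simplex_direction) auto

lemma continuous_on_L2_set: "continuous_on S (\<lambda>x::nat \<Rightarrow> real. L2_set x {..<k})"
  unfolding L2_set_def by (intro continuous_intros continuous_on_coordinate)

text \<open>Only the zeros of the gauge are critical. There the quotient of direction and gauge
  stays bounded, by \<open>k\<close> from above and by -1 from below, so \<open>k + 1\<close> serves
  both sides; the remaining factor, the norm, tends to 0, which agrees with the value of the
  formula.\<close>

lemma continuous_on_disc_to_simplex:
  assumes "i \<le> k"
  shows "continuous_on S (\<lambda>x. disc_to_simplex k x i)"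
proof -
  let ?q = "\<lambda>x. simplex_direction k x i * L2_set x {..<k} / simplex_gauge k x"
  note cont = continuous_on_simplex_direction[of UNIV k i] continuous_on_simplex_gauge[of UNIV k]
    continuous_on_L2_set[of UNIV k]
  have "(?q \<longlongrightarrow> ?q x) (at x)" for x
  proof (cases "simplex_gauge k x = 0")
    case False
    then show ?thesis
      using cont by (intro tendsto_intros) (auto simp: continuous_on_def)
  next
    case True
    have bound: "norm (?q y) \<le> (k + 1) * L2_set y {..<k}" for y
    proof (cases "simplex_gauge k y = 0")
      case False
      then have pos: "0 < simplex_gauge k y" using simplex_gauge_nonneg[of k y] by linarith
      have "\<bar>simplex_direction k y i\<bar> \<le> (k + 1) * simplex_gauge k y"
      proof -
        have "0 \<le> k * simplex_gauge k y" using pos by simp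
        then show ?thesis
          using simplex_direction_le[OF assms, of y] neg_simplex_direction_le_gauge[OF assms, of y]
            pos unfolding of_nat_add of_nat_1 distrib_right mult_1 by linarith
      qed
      then have "\<bar>simplex_direction k y i\<bar> * L2_set y {..<k}
          \<le> ((k + 1) * simplex_gauge k y) * L2_set y {..<k}"
        by (intro mult_right_mono) auto
      then show ?thesis using pos
        by (simp add: abs_mult field_simps)
    qed auto
    have "((\<lambda>y. L2_set y {..<k}) \<longlongrightarrow> L2_set x {..<k}) (at x)"
      using cont(3) by (simp add: continuous_on_def)
    moreover have "L2_set x {..<k} = 0"
      using True by (simp add: simplex_gauge_eq_0_iff L2_set_def)
    ultimately have "((\<lambda>y. (k + 1) * L2_set y {..<k}) \<longlongrightarrow> 0) (at x)"
      by (auto intro: tendsto_mult_right_zero)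
    then have "(?q \<longlongrightarrow> 0) (at x)"
      by (rule Lim_null_comparison[rotated]) (use bound in auto)
    then show ?thesis using True by simp
  qed
  then have "continuous_on UNIV ?q" by (simp add: continuous_on_def)
  then have "continuous_on S ?q" by (rule continuous_on_subset) simp
  then show ?thesis unfolding disc_to_simplex_def
    by (rule continuous_on_divide[OF continuous_on_add[OF continuous_on_const] continuous_on_const])
      auto
qed

lemma sum_disc_to_simplex: "(\<Sum>i\<le>k. disc_to_simplex k x i) = 1"
  unfolding disc_to_simplex_def
  by (simp add: sum.distrib sum_simplex_direction
      flip: sum_divide_distrib sum_distrib_right)

text \<open>Divided by the gauge, every direction entry is at least -1, hence at least minus the
  norm after rescaling. Nonnegativity on the ball and positivity in its interior are both read off
  from this bound.\<close>

lemma disc_to_simplex_ge: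
  assumes "i \<le> k"
  shows "(1 - L2_set x {..<k}) / real (k + 1) \<le> disc_to_simplex k x i"
proof (cases "simplex_gauge k x = 0")
  case True
  then show ?thesis unfolding disc_to_simplex_def by (intro divide_right_mono) auto
next
  case False
  then have pos: "0 < simplex_gauge k x" using simplex_gauge_nonneg[of k x] by linarith
  have "- simplex_direction k x i * L2_set x {..<k} \<le> simplex_gauge k x * L2_set x {..<k}"
    by (intro mult_right_mono neg_simplex_direction_le_gauge assms) simp
  then have "- L2_set x {..<k} \<le> simplex_direction k x i * L2_set x {..<k} / simplex_gauge k x"
    using pos by (simp add: field_simps)
  then show ?thesis
    unfolding disc_to_simplex_def by (intro divide_right_mono) auto
qed

lemma L2_set_le_1_iff: "L2_set x A \<le> 1 \<longleftrightarrow> (\<Sum>i\<in>A. (x i)\<^sup>2) \<le> 1"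
  by (simp add: L2_set_def)

lemma disc_interior_eq:
  "disc_interior k = {x. (\<forall>i\<ge>k. x i = 0) \<and> L2_set x {..<k} < 1}"
  by (auto simp: disc_interior_def topspace_closed_disc L2_set_def)

lemma disc_boundary_eq:
  "disc_boundary k = {x. (\<forall>i\<ge>k. x i = 0) \<and> L2_set x {..<k} = 1}"
  by (auto simp: disc_boundary_def topspace_closed_disc L2_set_def)

lemma topspace_closed_disc_eq_Un:
  "topspace (closed_disc k) = disc_interior k \<union> disc_boundary k"
  by (auto simp: disc_interior_def disc_boundary_def topspace_closed_disc)

lemma disc_to_simplex_nonneg:
  assumes "x \<in> topspace (closed_disc k)" "i \<le> k"
  shows "0 \<le> disc_to_simplex k x i"
proof -
  have "0 \<le> (1 - L2_set x {..<k}) / real (k + 1)"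
    using assms(1) by (simp add: topspace_closed_disc L2_set_le_1_iff)
  then show ?thesis using disc_to_simplex_ge[OF assms(2), of x] by linarith
qed

lemma disc_to_simplex_interior_pos:
  assumes "x \<in> disc_interior k" "i \<le> k"
  shows "0 < disc_to_simplex k x i"
proof -
  have "0 < (1 - L2_set x {..<k}) / real (k + 1)"
    using assms(1) by (simp add: disc_interior_eq)
  then show ?thesis using disc_to_simplex_ge[OF assms(2), of x] by linarith
qed

text \<open>An index at which the gauge is attained has rescaled direction -1 when the norm is
  1.\<close>

lemma disc_to_simplex_boundary:
  assumes "x \<in> disc_boundary k"
  shows "\<exists>i\<le>k. disc_to_simplex k x i = 0"
proof -
  have "simplex_gauge k x \<noteq> 0"
  proof
    assume "simplex_gauge k x = 0"
    then have "L2_set x {..<k} = 0" by (simp add: simplex_gauge_eq_0_iff L2_set_def)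
    then show False using assms by (simp add: disc_boundary_eq)
  qed
  moreover obtain i where "i \<le> k" "simplex_gauge k x = - simplex_direction k x i"
    by (rule simplex_gauge_attained)
  moreover have "L2_set x {..<k} = 1" using assms by (simp add: disc_boundary_eq)
  ultimately have "disc_to_simplex k x i = 0" by (simp add: disc_to_simplex_def)
  with \<open>i \<le> k\<close> show ?thesis by blast
qed

lemma simplex_gauge_scale:
  assumes "0 \<le> c" "\<And>i. i \<le> k \<Longrightarrow> simplex_direction k y i = c * simplex_direction k x i"
  shows "simplex_gauge k y = c * simplex_gauge k x"
proof (rule antisym)
  obtain i where "i \<le> k" "simplex_gauge k y = - simplex_direction k y i"
    by (rule simplex_gauge_attained)
  then show "simplex_gauge k y \<le> c * simplex_gauge k x"
    using assms neg_simplex_direction_le_gauge[of i k x] mult_left_mono[of _ _ c] by fastforce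
next
  obtain i where "i \<le> k" "simplex_gauge k x = - simplex_direction k x i"
    by (rule simplex_gauge_attained)
  then show "c * simplex_gauge k x \<le> simplex_gauge k y"
    using assms neg_simplex_direction_le_gauge[of i k y] by simp
qed

text \<open>Equal images have proportional directions. Norm and gauge are both positively
  homogeneous of degree 1, so their quotient does not see the factor of proportionality, which must
  then be 1. The origin is treated separately, since there the quotient is the default 0.\<close>

lemma inj_on_disc_to_simplex:
  assumes x: "\<forall>i\<ge>k. x i = 0" and y: "\<forall>i\<ge>k. y i = 0"
    and eq: "\<And>i. i \<le> k \<Longrightarrow> disc_to_simplex k x i = disc_to_simplex k y i"
  shows "x = y"
proof -
  let ?r = "\<lambda>x. L2_set x {..<k} / simplex_gauge k x"
  have zero: "x = (\<lambda>_. 0)" if "\<forall>i\<ge>k. x i = 0" "?r x = 0" for x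
  proof -
    have "\<forall>i<k. x i = 0"
      using that(2) by (auto simp: simplex_gauge_eq_0_iff L2_set_eq_0_iff)
    then show ?thesis using that(1) by (metis not_le)
  qed
  have dir: "simplex_direction k x i * ?r x = simplex_direction k y i * ?r y" if "i \<le> k" for i
    using eq[OF that] by (simp add: disc_to_simplex_def)
  have r0: "0 \<le> ?r z" for z by (simp add: simplex_gauge_nonneg)
  show ?thesis
  proof (cases "?r x = 0 \<or> ?r y = 0")
    case True
    \<comment> \<open>If \<open>v\<close> were not the origin, its ratio would be nonzero, so all
      its directions would vanish, which again makes it the origin.\<close>
    have aux: "v = (\<lambda>_. 0)" if "?r u = 0" "\<forall>i\<ge>k. v i = 0"
      and uv: "\<And>i. i \<le> k \<Longrightarrow> simplex_direction k u i * ?r u = simplex_direction k v i * ?r v" for u v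
    proof (rule ccontr)
      assume "v \<noteq> (\<lambda>_. 0)"
      then have "?r v \<noteq> 0" using zero[OF that(2)] by blast
      then have "simplex_direction k v i = 0" if "i \<le> k" for i
        using \<open>?r u = 0\<close> uv[OF that] by (metis mult_eq_0_iff)
      then have "\<forall>i<k. v i = 0" by (metis less_imp_le simplex_direction_def)
      then show False using that(2) \<open>v \<noteq> (\<lambda>_. 0)\<close> by (metis not_le)
    qed
    show ?thesis
      using True aux[of x y] aux[of y x] zero[OF x] zero[OF y] dir x y by metis
  next
    case False
    then have pos: "0 < ?r x" "0 < ?r y" using r0[of x] r0[of y] by linarith+
    then have gx: "simplex_gauge k x \<noteq> 0" "simplex_gauge k y \<noteq> 0" by auto
    define c where "c = ?r x / ?r y"
    have c: "0 < c" unfolding c_def using pos by (rule divide_pos_pos)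
    have yc: "simplex_direction k y i = c * simplex_direction k x i" if "i \<le> k" for i
      using dir[OF that] pos unfolding c_def by (metis False mult.commute nonzero_mult_div_cancel_right times_divide_eq_left)
    have gauge: "simplex_gauge k y = c * simplex_gauge k x"
      using c yc by (intro simplex_gauge_scale) auto
    have yx: "y i = c * x i" if "i < k" for i
      using yc[of i] that by (simp add: simplex_direction_def)
    have "L2_set y {..<k} = L2_set (\<lambda>i. c * x i) {..<k}"
      by (intro L2_set_cong) (auto simp: yx)
    also have "\<dots> = c * L2_set x {..<k}"
      using c by (simp add: L2_set_right_distrib)
    finally have "L2_set y {..<k} = c * L2_set x {..<k}" .
    then have "?r y = ?r x" using c gauge by simp
    then have "c = 1" using pos unfolding c_def by (metis divide_self less_irrefl)
    then show ?thesis using yx x y by (metis ext mult_1 not_le)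
  qed
qed

lemma disc_to_simplex_surj:
  assumes pos: "\<And>i. i \<le> k \<Longrightarrow> 0 < \<alpha> i" and sum1: "(\<Sum>i\<le>k. \<alpha> i) = 1"
  shows "\<exists>x\<in>disc_interior k. \<forall>i\<le>k. disc_to_simplex k x i = \<alpha> i"
proof -
  \<comment> \<open>This inverts the affine part of \<open>disc_to_simplex\<close>; the last
    direction entry comes out right because \<alpha> sums to 1.\<close>
  define b where "b i = (if i < k then (k + 1) * \<alpha> i - 1 else 0)" for i
  have sum_b: "(\<Sum>i<k. b i) = - ((k + 1) * \<alpha> k - 1)"
  proof -
    have "(\<Sum>i<k. b i) = (\<Sum>i<k. (k + 1) * \<alpha> i - 1)"
      by (intro sum.cong) (auto simp: b_def)
    also have "\<dots> = (k + 1) * (\<Sum>i<k. \<alpha> i) - k"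
      by (simp add: sum_subtractf sum_distrib_left)
    also have "(\<Sum>i<k. \<alpha> i) = 1 - \<alpha> k"
      using sum1 by (simp flip: lessThan_Suc_atMost)
    finally show ?thesis by (simp add: algebra_simps)
  qed
  have dir_b: "simplex_direction k b i = (k + 1) * \<alpha> i - 1" if "i \<le> k" for i
  proof (cases "i < k")
    case False
    then have "i = k" using that by simp
    then show ?thesis using sum_b by (simp add: simplex_direction_def)
  qed (simp add: simplex_direction_def b_def)
  have gauge_b: "simplex_gauge k b < 1"
  proof -
    obtain i where "i \<le> k" "simplex_gauge k b = - simplex_direction k b i"
      by (rule simplex_gauge_attained)
    then show ?thesis using pos[of i] dir_b[of i] by (simp add: add_pos_nonneg)
  qed
  show ?thesis
  proof (cases "simplex_gauge k b = 0")
    case True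
    then have b0: "b i = 0" for i by (simp add: simplex_gauge_eq_0_iff b_def)
    then have dir0: "simplex_direction k b i = 0" for i
      by (simp add: simplex_direction_def)
    have "disc_to_simplex k b i = \<alpha> i" if "i \<le> k" for i
      using dir_b[OF that] True dir0[of i] by (simp add: disc_to_simplex_def field_simps)
    moreover have "b \<in> disc_interior k" using b0 by (simp add: disc_interior_eq L2_set_def)
    ultimately show ?thesis by blast
  next
    case False
    then have g: "0 < simplex_gauge k b" using simplex_gauge_nonneg[of k b] by linarith
    have L: "0 < L2_set b {..<k}"
      using False by (metis L2_set_eq_0_iff L2_set_nonneg finite_lessThan lessThan_iff
          order_le_less simplex_gauge_eq_0_iff)
    \<comment> \<open>With this factor the norm of \<open>x\<close> is the gauge of
      \<open>b\<close>, which is below 1 because \<alpha> is positive. The quotient of norm and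
      gauge at \<open>x\<close> is then \<open>1 / c\<close>, which cancels the factor
      again.\<close>
    define c where "c = simplex_gauge k b / L2_set b {..<k}"
    have c: "0 < c" using g L by (simp add: c_def)
    define x where "x i = c * b i" for i
    have L_x: "L2_set x {..<k} = simplex_gauge k b"
    proof -
      have "L2_set x {..<k} = c * L2_set b {..<k}"
        using c unfolding x_def by (simp add: L2_set_right_distrib)
      then show ?thesis using L by (simp add: c_def)
    qed
    have dir_x: "simplex_direction k x i = c * simplex_direction k b i" for i
      by (simp add: simplex_direction_def x_def sum_distrib_left)
    then have gauge_x: "simplex_gauge k x = c * simplex_gauge k b"
      using c by (intro simplex_gauge_scale) auto
    have "disc_to_simplex k x i = \<alpha> i" if "i \<le> k" for i
      using g c dir_b[OF that] by (simp add: disc_to_simplex_def dir_x gauge_x L_x field_simps)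
    moreover have "x \<in> disc_interior k"
      using gauge_b by (simp add: disc_interior_eq L_x) (simp add: x_def b_def)
    ultimately show ?thesis by blast
  qed
qed

section \<open>Open simplices as the cells of a realization\<close>

definition open_simplex :: "'v set \<Rightarrow> ('v \<Rightarrow> real) set" where
  "open_simplex S = {\<alpha>. (\<forall>v. 0 \<le> \<alpha> v) \<and> {v. \<alpha> v \<noteq> 0} = S \<and> sum \<alpha> S = 1}"

lemma topspace_realization: "topspace (realization K) = (\<Union>S\<in>K. open_simplex S)"
  by (auto simp: realization_def open_simplex_def)

lemma realization_eq: "realization K = top_of_set (\<Union>S\<in>K. open_simplex S)"
  unfolding topspace_realization[symmetric] by (simp add: realization_def)

lemma Hausdorff_space_realization: "Hausdorff_space (realization K)"
proof -
  have "Hausdorff_space (powertop_real UNIV :: ('v \<Rightarrow> real) topology)"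
    by (simp add: Hausdorff_space_product_topology)
  then show ?thesis
    unfolding realization_def euclidean_product_topology by (rule Hausdorff_space_subtopology)
qed

lemma open_simplex_disjoint: "\<alpha> \<in> open_simplex S \<Longrightarrow> \<alpha> \<in> open_simplex T \<Longrightarrow> S = T"
  by (simp add: open_simplex_def)

lemma barycentre_in_open_simplex:
  assumes "finite S" "S \<noteq> {}"
  shows "(\<lambda>v. if v \<in> S then 1 / card S else 0) \<in> open_simplex S"
proof -
  have "real (card S) \<noteq> 0" using assms by simp
  then have "{v. (if v \<in> S then 1 / real (card S) else 0) \<noteq> 0} = S" by simp
  moreover have "(\<Sum>v\<in>S. if v \<in> S then 1 / real (card S) else 0) = 1"
    using \<open>real (card S) \<noteq> 0\<close> by simp
  ultimately show ?thesis unfolding open_simplex_def by simp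
qed

lemma open_simplex_characteristic_map:
  assumes "finite S" "S \<noteq> {}"
  obtains \<phi> :: "(nat \<Rightarrow> real) \<Rightarrow> 'v \<Rightarrow> real" where
    "\<And>D. continuous_on D \<phi>"
    "\<phi> ` disc_interior (card S - 1) = open_simplex S"
    "inj_on \<phi> (disc_interior (card S - 1))"
    "\<phi> ` disc_boundary (card S - 1) \<subseteq> (\<Union>T\<in>{T. T \<noteq> {} \<and> T \<subset> S}. open_simplex T)"
proof -
  define k where "k = card S - 1"
  have card_S: "card S = Suc k"
    using assms by (simp add: k_def card_gt_0_iff)
  obtain h where h: "bij_betw h S {..k}"
    using ex_bij_betw_finite_nat[OF assms(1)] card_S by (auto simp: atLeast0LessThan lessThan_Suc_atMost)
  define \<phi> where "\<phi> x v = (if v \<in> S then disc_to_simplex k x (h v) else 0)" for x v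
  have h_le: "h v \<le> k" if "v \<in> S" for v
    using h that by (auto simp: bij_betw_def)
  have h_surj: "\<exists>v\<in>S. h v = i" if "i \<le> k" for i
    using h that by (metis atMost_iff bij_betw_imp_surj_on imageE)
  have sum_\<phi>: "sum (\<phi> x) S = 1" for x
  proof -
    have "sum (\<phi> x) S = (\<Sum>v\<in>S. disc_to_simplex k x (h v))"
      by (intro sum.cong) (auto simp: \<phi>_def)
    also have "\<dots> = (\<Sum>i\<le>k. disc_to_simplex k x i)"
      by (rule sum.reindex_bij_betw[OF h])
    finally show ?thesis by (simp add: sum_disc_to_simplex)
  qed
  show thesis
  proof (rule that[of \<phi>]; (fold k_def)?)
    show "continuous_on D \<phi>" for D
    proof (rule continuous_on_coordinatewise_then_product)
      show "continuous_on D (\<lambda>x. \<phi> x v)" for v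
        by (cases "v \<in> S") (auto simp: \<phi>_def intro!: continuous_on_disc_to_simplex h_le)
    qed
    show "inj_on \<phi> (disc_interior k)"
    proof (rule inj_onI)
      fix x y
      assume xy: "x \<in> disc_interior k" "y \<in> disc_interior k" "\<phi> x = \<phi> y"
      have "disc_to_simplex k x i = disc_to_simplex k y i" if i: "i \<le> k" for i
      proof -
        obtain v where "v \<in> S" "h v = i" using h_surj[OF i] by blast
        then show ?thesis using fun_cong[OF xy(3), of v] by (simp add: \<phi>_def)
      qed
      then show "x = y"
        using xy by (intro inj_on_disc_to_simplex[of k]) (auto simp: disc_interior_eq)
    qed
    show "\<phi> ` disc_interior k = open_simplex S"
    proof (intro equalityI subsetI)
      fix \<alpha> assume "\<alpha> \<in> \<phi> ` disc_interior k"
      then obtain x where x: "x \<in> disc_interior k" "\<alpha> = \<phi> x" by blast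
      have "0 < \<phi> x v" if "v \<in> S" for v
        using disc_to_simplex_interior_pos[OF x(1) h_le[OF that]] that by (simp add: \<phi>_def)
      moreover have "\<phi> x v = 0" if "v \<notin> S" for v
        using that by (simp add: \<phi>_def)
      ultimately have "{v. \<phi> x v \<noteq> 0} = S" "\<forall>v. 0 \<le> \<phi> x v"
        by (auto simp: less_le) (metis order_refl)+
      then show "\<alpha> \<in> open_simplex S"
        using x sum_\<phi>[of x] by (simp add: open_simplex_def)
    next
      fix \<alpha> assume \<alpha>: "\<alpha> \<in> open_simplex S"
      define g where "g = inv_into S h"
      have g: "bij_betw g {..k} S" unfolding g_def by (rule bij_betw_inv_into[OF h])
      have "\<exists>x\<in>disc_interior k. \<forall>i\<le>k. disc_to_simplex k x i = \<alpha> (g i)"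
      proof (rule disc_to_simplex_surj)
        show "0 < \<alpha> (g i)" if "i \<le> k" for i
        proof -
          have "g i \<in> S" using g that by (auto simp: bij_betw_def)
          then show ?thesis using \<alpha> by (auto simp: open_simplex_def less_le)
        qed
        show "(\<Sum>i\<le>k. \<alpha> (g i)) = 1"
          using \<alpha> by (simp add: sum.reindex_bij_betw[OF g] open_simplex_def)
      qed
      then obtain x where x: "x \<in> disc_interior k" "\<And>i. i \<le> k \<Longrightarrow> disc_to_simplex k x i = \<alpha> (g i)"
        by blast
      have "\<phi> x = \<alpha>"
      proof
        fix v
        show "\<phi> x v = \<alpha> v"
        proof (cases "v \<in> S")
          case True
          then show ?thesis
            using x(2)[OF h_le[OF True]] h
            by (simp add: \<phi>_def g_def inv_into_f_f bij_betw_imp_inj_on)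
        next
          case False
          then show ?thesis using \<alpha> by (auto simp: \<phi>_def open_simplex_def)
        qed
      qed
      then show "\<alpha> \<in> \<phi> ` disc_interior k" using x(1) by blast
    qed
    show "\<phi> ` disc_boundary k \<subseteq> (\<Union>T\<in>{T. T \<noteq> {} \<and> T \<subset> S}. open_simplex T)"
    proof
      fix \<alpha> assume "\<alpha> \<in> \<phi> ` disc_boundary k"
      then obtain x where x: "x \<in> disc_boundary k" "\<alpha> = \<phi> x" by blast
      let ?T = "{v. \<phi> x v \<noteq> 0}"
      have "?T \<subseteq> S" by (auto simp: \<phi>_def)
      obtain v where "v \<in> S" "\<phi> x v = 0"
        using disc_to_simplex_boundary[OF x(1)] h_surj by (auto simp: \<phi>_def)
      then have "?T \<subset> S" using \<open>?T \<subseteq> S\<close> by blast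
      have "0 \<le> \<phi> x v" for v
        using x(1) by (auto simp: \<phi>_def topspace_closed_disc_eq_Un intro!: disc_to_simplex_nonneg h_le)
      moreover have "sum (\<phi> x) ?T = 1"
        using sum_\<phi>[of x] \<open>?T \<subseteq> S\<close> assms(1) by (subst sum.mono_neutral_left[of S]) auto
      ultimately have "\<phi> x \<in> open_simplex ?T" by (simp add: open_simplex_def)
      moreover have "?T \<noteq> {}" using \<open>sum (\<phi> x) ?T = 1\<close> by (metis sum.empty zero_neq_one)
      ultimately show "\<alpha> \<in> (\<Union>T\<in>{T. T \<noteq> {} \<and> T \<subset> S}. open_simplex T)"
        using \<open>?T \<subset> S\<close> unfolding x(2) by (intro UN_I[of ?T]) simp_all
    qed
  qed
qed

text \<open>A continuous map from a compact to a Hausdorff space is closed, and it stays closed when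
  restricted to a set that is a full preimage. The last hypothesis makes \<open>U\<close> such a
  set, so no inverse map has to be examined.\<close>

lemma homeomorphic_map_saturated:
  assumes "compact_space X" "Hausdorff_space Y" "continuous_map X Y f"
    and "U \<subseteq> topspace X" "inj_on f U" "f ` U \<inter> f ` (topspace X - U) = {}"
  shows "homeomorphic_map (subtopology X U) (subtopology Y (f ` U)) f"
proof (rule bijective_closed_imp_homeomorphic_map)
  show "continuous_map (subtopology X U) (subtopology Y (f ` U)) f"
    using assms by (auto simp: continuous_map_in_subtopology continuous_map_from_subtopology)
  show "closed_map (subtopology X U) (subtopology Y (f ` U)) f"
    using assms
    by (intro closed_map_restriction continuous_imp_closed_map) blast+
  have "f ` U \<subseteq> topspace Y"
    using assms(3,4) continuous_map_image_subset_topspace by blast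
  then show "f ` topspace (subtopology X U) = topspace (subtopology Y (f ` U))"
    using assms(4) by (simp add: Int_absorb1)
  show "inj_on f (topspace (subtopology X U))"
    using assms(4,5) by (simp add: Int_absorb1)
qed

theorem CW_complex_dim_le_realization:
  assumes "finite K"
    and K: "\<And>S. S \<in> K \<Longrightarrow> finite S \<and> S \<noteq> {} \<and> card S \<le> Suc m"
    and sub: "\<And>S T. S \<in> K \<Longrightarrow> T \<subseteq> S \<Longrightarrow> T \<noteq> {} \<Longrightarrow> T \<in> K"
  shows "CW_complex_dim_le m (realization K)"
proof -
  let ?X = "realization K"
  define P where "P S \<phi> \<longleftrightarrow> (\<forall>D. continuous_on D \<phi>) \<and>
    \<phi> ` disc_interior (card S - 1) = open_simplex S \<and>
    inj_on \<phi> (disc_interior (card S - 1)) \<and>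
    \<phi> ` disc_boundary (card S - 1) \<subseteq> (\<Union>T\<in>{T. T \<noteq> {} \<and> T \<subset> S}. open_simplex T)"
    for S :: "'a set" and \<phi> :: "(nat \<Rightarrow> real) \<Rightarrow> 'a \<Rightarrow> real"
  have "\<forall>S\<in>K. \<exists>\<phi>. P S \<phi>"
  proof
    fix S assume "S \<in> K"
    then have "finite S" "S \<noteq> {}" using K by auto
    then show "\<exists>\<phi>. P S \<phi>"
      unfolding P_def by (rule open_simplex_characteristic_map) blast
  qed
  then obtain \<phi> where \<phi>: "\<And>S. S \<in> K \<Longrightarrow> P S (\<phi> S)" by metis
  have nonempty: "open_simplex S \<noteq> {}" if "S \<in> K" for S
    using barycentre_in_open_simplex[of S] K[OF that] by blast
  define E where "E = open_simplex ` K"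
  have Union_E: "\<Union>E = topspace ?X" by (simp add: E_def topspace_realization)
  have inj: "inj_on open_simplex K"
    by (rule inj_onI) (metis nonempty open_simplex_disjoint ex_in_conv)
  \<comment> \<open>A CW structure attaches dimension and characteristic map to the cell itself, so
    the vertex set must be recovered from the open simplex.\<close>
  define vs where "vs = inv_into K open_simplex"
  have vs: "vs (open_simplex S) = S" if "S \<in> K" for S
    using that inj by (simp add: vs_def)
  define d where "d e = card (vs e) - 1" for e :: "('a \<Rightarrow> real) set"
  have d: "d (open_simplex S) = card S - 1" if "S \<in> K" for S
    using that by (simp add: d_def vs)
  have boundary: "\<phi> S ` disc_boundary (card S - 1)
      \<subseteq> \<Union>(open_simplex ` {T \<in> K. T \<subset> S})" if "S \<in> K" for S
    using \<phi>[OF that] sub[OF that] unfolding P_def by blast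
  have image: "\<phi> S ` topspace (closed_disc (card S - 1)) \<subseteq> topspace ?X" if "S \<in> K" for S
  proof -
    have "\<phi> S ` disc_interior (card S - 1) = open_simplex S"
      using \<phi>[OF that] by (simp add: P_def)
    moreover have "\<Union>(open_simplex ` {T \<in> K. T \<subset> S}) \<subseteq> topspace ?X"
      by (auto simp: topspace_realization)
    moreover have "open_simplex S \<subseteq> topspace ?X"
      using that by (auto simp: topspace_realization)
    ultimately show ?thesis
      using boundary[OF that] by (simp add: topspace_closed_disc_eq_Un image_Un)
  qed
  have cont: "continuous_map (closed_disc (card S - 1)) ?X (\<phi> S)" if "S \<in> K" for S
    using \<phi>[OF that] image[OF that] unfolding P_def realization_eq topspace_realization
    by (subst closed_disc_eq) auto
  have homeo: "homeomorphic_map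
      (subtopology (closed_disc (card S - 1)) (disc_interior (card S - 1)))
      (subtopology ?X (open_simplex S)) (\<phi> S)" if "S \<in> K" for S
  proof -
    have "homeomorphic_map
      (subtopology (closed_disc (card S - 1)) (disc_interior (card S - 1)))
      (subtopology ?X (\<phi> S ` disc_interior (card S - 1))) (\<phi> S)"
    proof (intro homeomorphic_map_saturated compact_space_closed_disc
        Hausdorff_space_realization cont that)
      show "disc_interior (card S - 1) \<subseteq> topspace (closed_disc (card S - 1))"
        by (simp add: topspace_closed_disc_eq_Un)
      show "inj_on (\<phi> S) (disc_interior (card S - 1))"
        using \<phi>[OF that] by (simp add: P_def)
      have "topspace (closed_disc (card S - 1)) - disc_interior (card S - 1)
          \<subseteq> disc_boundary (card S - 1)"
        by (auto simp: topspace_closed_disc_eq_Un)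
      then have "\<phi> S ` (topspace (closed_disc (card S - 1)) - disc_interior (card S - 1))
          \<subseteq> \<Union>(open_simplex ` {T \<in> K. T \<subset> S})"
        using boundary[OF that] by blast
      moreover have "open_simplex S \<inter> \<Union>(open_simplex ` {T \<in> K. T \<subset> S}) = {}"
        using open_simplex_disjoint by blast
      moreover have "\<phi> S ` disc_interior (card S - 1) = open_simplex S"
        using \<phi>[OF that] by (simp add: P_def)
      ultimately show "\<phi> S ` disc_interior (card S - 1) \<inter>
          \<phi> S ` (topspace (closed_disc (card S - 1)) - disc_interior (card S - 1)) = {}"
        by blast
    qed
    then show ?thesis using \<phi>[OF that] by (simp add: P_def)
  qed
  have closed: "closedin ?X (\<phi> S ` topspace (closed_disc (card S - 1)))" if "S \<in> K" for S
    using cont[OF that] compact_space_closed_disc Hausdorff_space_realization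
    by (metis closed_map_def closedin_topspace continuous_imp_closed_map)
  have "CW_structure ?X E d (\<lambda>e. \<phi> (vs e))"
    unfolding CW_structure_def
  proof (intro conjI ballI allI impI)
    show "Hausdorff_space ?X" by (rule Hausdorff_space_realization)
    show "pairwise disjnt E"
      by (auto simp: pairwise_def E_def disjnt_def dest: open_simplex_disjoint)
    show "\<Union>E = topspace ?X" by (rule Union_E)
    fix e assume "e \<in> E"
    then obtain S where S: "S \<in> K" "e = open_simplex S" by (auto simp: E_def)
    show "continuous_map (closed_disc (d e)) ?X (\<phi> (vs e))"
      using cont S by (simp add: d vs)
    show "homeomorphic_map (subtopology (closed_disc (d e)) (disc_interior (d e)))
               (subtopology ?X e) (\<phi> (vs e))"
      using homeo S by (simp add: d vs)
    show "\<exists>F. finite F \<and> F \<subseteq> {e' \<in> E. d e' < d e} \<and> \<phi> (vs e) ` disc_boundary (d e) \<subseteq> \<Union>F"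
    proof (intro exI conjI)
      show "finite (open_simplex ` {T \<in> K. T \<subset> S})" using \<open>finite K\<close> by simp
      \<comment> \<open>The subtraction is truncated: strictness relies on \<open>T\<close> being
        nonempty.\<close>
      have "card T - 1 < card S - 1" if "T \<in> K" "T \<subset> S" for T
        using that K S(1) psubset_card_mono[of S T] card_gt_0_iff[of T] by fastforce
      then show "open_simplex ` {T \<in> K. T \<subset> S} \<subseteq> {e' \<in> E. d e' < d e}"
        using S by (intro image_subsetI) (simp add: E_def d)
      show "\<phi> (vs e) ` disc_boundary (d e) \<subseteq> \<Union>(open_simplex ` {T \<in> K. T \<subset> S})"
        using boundary[OF S(1)] S by (simp add: d vs)
    qed
  next
    fix A assume A: "A \<subseteq> topspace ?X"
    let ?C = "\<lambda>e. \<phi> (vs e) ` topspace (closed_disc (d e))"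
    have closed_C: "closedin ?X (?C e)" if "e \<in> E" for e
      using that closed by (auto simp: E_def d vs)
    have e_C: "e \<subseteq> ?C e" if "e \<in> E" for e
    proof -
      obtain S where S: "S \<in> K" "e = open_simplex S" using \<open>e \<in> E\<close> by (auto simp: E_def)
      then show ?thesis
        using \<phi>[OF S(1)] by (auto simp: P_def d vs topspace_closed_disc_eq_Un)
    qed
    \<comment> \<open>Finitely many closed cells cover the space, so the weak topology condition
      reduces to a finite union of closed sets.\<close>
    have A_eq: "A = (\<Union>e\<in>E. A \<inter> ?C e)"
    proof (rule antisym)
      show "A \<subseteq> (\<Union>e\<in>E. A \<inter> ?C e)"
      proof
        fix \<alpha> assume "\<alpha> \<in> A"
        then obtain e where "e \<in> E" "\<alpha> \<in> e"
          using A unfolding Union_E[symmetric] by blast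
        have "\<alpha> \<in> A \<inter> ?C e"
          using \<open>\<alpha> \<in> A\<close> subsetD[OF e_C[OF \<open>e \<in> E\<close>] \<open>\<alpha> \<in> e\<close>] by (rule IntI)
        with \<open>e \<in> E\<close> show "\<alpha> \<in> (\<Union>e\<in>E. A \<inter> ?C e)" by (rule UN_I)
      qed
    qed (rule UN_least, rule Int_lower1)
    show "closedin ?X A \<longleftrightarrow> (\<forall>e\<in>E. closedin ?X (A \<inter> ?C e))"
    proof
      assume "closedin ?X A"
      then show "\<forall>e\<in>E. closedin ?X (A \<inter> ?C e)" using closed_C by blast
    next
      assume "\<forall>e\<in>E. closedin ?X (A \<inter> ?C e)"
      then have "closedin ?X (\<Union>e\<in>E. A \<inter> ?C e)"
        using \<open>finite K\<close> by (intro closedin_Union) (auto simp: E_def)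
      then show "closedin ?X A" unfolding A_eq[symmetric] .
    qed
  qed
  moreover have "\<forall>e\<in>E. d e \<le> m"
  proof
    fix e assume "e \<in> E"
    then obtain S where S: "S \<in> K" "e = open_simplex S" by (auto simp: E_def)
    then show "d e \<le> m" using K[OF S(1)] by (auto simp: d)
  qed
  ultimately show ?thesis unfolding CW_complex_dim_le_def by blast
qed

section \<open>Coning off the small faces of the facets\<close>

text \<open>The \<open>(k + 1)\<close>-st largest value of \<open>\<alpha>\<close> on \<open>A\<close>.\<close>

definition order_level :: "nat \<Rightarrow> 'v set \<Rightarrow> ('v \<Rightarrow> real) \<Rightarrow> real" where
  "order_level k A \<alpha> = (if card A \<le> k then 0 else
     Max ((\<lambda>S. Min (\<alpha> ` S)) ` {S. S \<subseteq> A \<and> card S = Suc k}))"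

context
  fixes A :: "'v set" and k :: nat
  assumes finA: "finite A"
begin

lemma Suc_subsets:
  shows "finite {S. S \<subseteq> A \<and> card S = Suc k}"
    and "k < card A \<Longrightarrow> {S. S \<subseteq> A \<and> card S = Suc k} \<noteq> {}"
    and "S \<subseteq> A \<Longrightarrow> card S = Suc k \<Longrightarrow> finite S \<and> S \<noteq> {}"
proof -
  show "finite {S. S \<subseteq> A \<and> card S = Suc k}"
    by (rule finite_subset[of _ "Pow A"]) (use finA in auto)
  show "{S. S \<subseteq> A \<and> card S = Suc k} \<noteq> {}" if "k < card A"
    using obtain_subset_with_card_n[of "Suc k" A] that by (auto simp: Suc_le_eq)
  show "finite S \<and> S \<noteq> {}" if "S \<subseteq> A" "card S = Suc k"
    using that(2) by (metis card.empty card.infinite nat.distinct(1))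
qed

lemma continuous_on_order_level: "continuous_on D (order_level k A)"
proof (cases "card A \<le> k")
  case False
  have "continuous_on D (\<lambda>\<alpha>. Max ((\<lambda>S. Min (\<alpha> ` S)) ` {S. S \<subseteq> A \<and> card S = Suc k}))"
  proof (rule continuous_on_Max_image)
    show "continuous_on D (\<lambda>\<alpha>. Min (\<alpha> ` S))" if "S \<in> {S. S \<subseteq> A \<and> card S = Suc k}" for S
    proof -
      have "finite S" "S \<noteq> {}" using that Suc_subsets(3)[of S] by blast+
      then show ?thesis by (rule continuous_on_Min_image) (rule continuous_on_coordinate)
    qed
    show "{S. S \<subseteq> A \<and> card S = Suc k} \<noteq> {}"
      using False by (intro Suc_subsets(2)) simp
  qed (rule Suc_subsets(1))
  then show ?thesis using False by (simp add: order_level_def[abs_def])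
qed (simp add: order_level_def[abs_def])

lemma Min_le_order_level:
  assumes "S \<subseteq> A" "card S = Suc k"
  shows "Min (\<alpha> ` S) \<le> order_level k A \<alpha>"
proof -
  have "k < card A" using card_mono[OF finA assms(1)] assms(2) by simp
  then show ?thesis
    using assms Suc_subsets(1) by (auto simp: order_level_def intro!: Max_ge)
qed

lemma order_level_attained:
  assumes "k < card A"
  obtains S where "S \<subseteq> A" "card S = Suc k" "order_level k A \<alpha> = Min (\<alpha> ` S)"
proof -
  have "Max ((\<lambda>S. Min (\<alpha> ` S)) ` {S. S \<subseteq> A \<and> card S = Suc k})
      \<in> (\<lambda>S. Min (\<alpha> ` S)) ` {S. S \<subseteq> A \<and> card S = Suc k}"
    using Suc_subsets(1) Suc_subsets(2)[OF assms] by (intro Max_in finite_imageI) blast+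
  then show ?thesis using that assms by (auto simp: order_level_def)
qed

lemma order_level_nonneg:
  assumes "\<And>v. 0 \<le> \<alpha> v"
  shows "0 \<le> order_level k A \<alpha>"
proof (cases "k < card A")
  case True
  then obtain S where "S \<subseteq> A" "card S = Suc k" "order_level k A \<alpha> = Min (\<alpha> ` S)"
    by (rule order_level_attained)
  then show ?thesis using assms Suc_subsets(3)[of S] by simp
qed (simp add: order_level_def)

text \<open>Otherwise \<open>k + 1\<close> of these vertices would form a set whose minimum exceeds
  the maximum over all such minima.\<close>

lemma card_above_order_level: "card {v \<in> A. order_level k A \<alpha> < \<alpha> v} \<le> k"
proof (rule ccontr)
  assume "\<not> ?thesis"
  then obtain S where S: "S \<subseteq> {v \<in> A. order_level k A \<alpha> < \<alpha> v}" "card S = Suc k"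
    using obtain_subset_with_card_n[of "Suc k"] by (metis not_less_eq_eq)
  then have "S \<subseteq> A" by blast
  then have "order_level k A \<alpha> < Min (\<alpha> ` S)"
    using S Suc_subsets(3)[of S] by auto
  then show False using Min_le_order_level[OF \<open>S \<subseteq> A\<close> S(2), of \<alpha>] by simp
qed

text \<open>Every set of \<open>k + 1\<close> vertices of \<open>A\<close> leaves the support. This
  will silence the correction of one facet at the points of another.\<close>

lemma order_level_eq_0:
  assumes "\<And>v. 0 \<le> \<alpha> v" "card {v \<in> A. \<alpha> v \<noteq> 0} \<le> k"
  shows "order_level k A \<alpha> = 0"
proof (cases "k < card A")
  case True
  then obtain S where S: "S \<subseteq> A" "card S = Suc k" "order_level k A \<alpha> = Min (\<alpha> ` S)"
    by (rule order_level_attained)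
  have "\<not> S \<subseteq> {v \<in> A. \<alpha> v \<noteq> 0}"
    using card_mono[of "{v \<in> A. \<alpha> v \<noteq> 0}" S] finA assms(2) S(2) by auto
  then obtain v where "v \<in> S" "\<alpha> v = 0" using S(1) by blast
  then have "Min (\<alpha> ` S) \<le> 0"
    using Suc_subsets(3)[OF S(1,2)] by (metis Min_le finite_imageI imageI)
  then show ?thesis using S(3) order_level_nonneg[of \<alpha>] assms(1) by simp
qed (simp add: order_level_def)

text \<open>Every set of \<open>k + 1\<close> vertices leaves \<open>T\<close> and so contains the
  least value \<open>s\<close>. Points \<open>pull \<beta>\<close> have this shape: a constant share
  everywhere, plus \<beta> at no more than \<open>k\<close> vertices.\<close>

lemma order_level_const_off_small_set:
  assumes "k < card A" "T \<subseteq> A" "card T \<le> k"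
    and "\<And>v. v \<in> A - T \<Longrightarrow> \<alpha> v = s" "\<And>v. v \<in> T \<Longrightarrow> s \<le> \<alpha> v"
  shows "order_level k A \<alpha> = s"
proof (rule antisym)
  obtain S where S: "S \<subseteq> A" "card S = Suc k" "order_level k A \<alpha> = Min (\<alpha> ` S)"
    using assms(1) by (rule order_level_attained)
  have "\<not> S \<subseteq> T"
    using card_mono[of T S] finite_subset[OF assms(2) finA] assms(3) S(2) by auto
  then obtain v where "v \<in> S" "\<alpha> v = s" using S(1) assms(4) by blast
  then show "order_level k A \<alpha> \<le> s"
    using S(3) Suc_subsets(3)[OF S(1,2)] by (metis Min_le finite_imageI imageI)
next
  obtain S where S: "S \<subseteq> A" "card S = Suc k"
    using Suc_subsets(2)[OF assms(1)] by blast
  have "s \<le> \<alpha> v" if "v \<in> A" for v using that assms(4,5) by (cases "v \<in> T") auto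
  then have "s \<le> Min (\<alpha> ` S)"
    using Suc_subsets(3)[OF S] S(1) by auto
  then show "s \<le> order_level k A \<alpha>" using Min_le_order_level[OF S, of \<alpha>] by simp
qed

end

section \<open>The homotopy equivalence between a union of facets and its coned version\<close>

definition facet_complex :: "'i set \<Rightarrow> ('i \<Rightarrow> 'v set) \<Rightarrow> 'v set set" where
  "facet_complex I A = {S. S \<noteq> {} \<and> (\<exists>i\<in>I. S \<subseteq> A i)}"

text \<open>The facet \<open>A i\<close> is replaced by the cone with apex \<open>p i\<close> over its faces with at most \<open>k\<close> vertices,
  except that facets with at most \<open>k\<close> vertices are kept and get no apex.\<close>

definition coned_complex :: "nat \<Rightarrow> 'i set \<Rightarrow> ('i \<Rightarrow> 'v set) \<Rightarrow> ('i \<Rightarrow> 'v) \<Rightarrow> 'v set set" where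
  "coned_complex k I A p = {S. S \<noteq> {} \<and> (\<exists>i\<in>I. S \<subseteq> insert (p i) (A i) \<and>
     card (S \<inter> A i) \<le> k \<and> (p i \<in> S \<longrightarrow> k < card (A i)))}"

lemma topspace_realization_iff:
  "\<alpha> \<in> topspace (realization K) \<longleftrightarrow>
     (\<forall>v. 0 \<le> \<alpha> v) \<and> {v. \<alpha> v \<noteq> 0} \<in> K \<and> (\<Sum>v | \<alpha> v \<noteq> 0. \<alpha> v) = 1"
  by (simp add: realization_def)

locale facets =
  fixes k :: nat and I :: "'i set" and A :: "'i \<Rightarrow> 'v set" and p :: "'i \<Rightarrow> 'v"
  assumes finite_I: "finite I"
    and finite_A: "i \<in> I \<Longrightarrow> finite (A i)"
    and card_Int_le: "i \<in> I \<Longrightarrow> j \<in> I \<Longrightarrow> i \<noteq> j \<Longrightarrow> card (A i \<inter> A j) \<le> k"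
    and inj_p: "inj_on p I"
    and p_notin_A: "i \<in> I \<Longrightarrow> j \<in> I \<Longrightarrow> p i \<notin> A j"
begin

abbreviation "K \<equiv> realization (facet_complex I A)"
abbreviation "L \<equiv> realization (coned_complex k I A p)"

text \<open>Summing over a whole facet instead of the support turns membership into linear
  conditions for a fixed \<open>j\<close>; the carriers of the maps and the segments of the homotopy
  can then be checked in one facet.\<close>

lemma topspace_K_iff:
  "\<alpha> \<in> topspace K \<longleftrightarrow>
     (\<forall>v. 0 \<le> \<alpha> v) \<and> (\<exists>j\<in>I. (\<forall>v. v \<notin> A j \<longrightarrow> \<alpha> v = 0) \<and> sum \<alpha> (A j) = 1)"
proof -
  have sum: "(\<Sum>v | \<alpha> v \<noteq> 0. \<alpha> v) = sum \<alpha> (A j)" if "j \<in> I" "{v. \<alpha> v \<noteq> 0} \<subseteq> A j" for j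
    using that finite_A by (intro sum.mono_neutral_left) auto
  have ne: "{v. \<alpha> v \<noteq> 0} \<noteq> {}" if "sum \<alpha> (A j) = 1" for j
    using that by (metis (mono_tags, lifting) empty_Collect_eq sum.neutral zero_neq_one)
  have supp: "{v. \<alpha> v \<noteq> 0} \<subseteq> A j \<longleftrightarrow> (\<forall>v. v \<notin> A j \<longrightarrow> \<alpha> v = 0)" for j by blast
  show ?thesis
    unfolding topspace_realization_iff facet_complex_def using sum ne
    by (simp only: mem_Collect_eq supp) metis
qed

lemma topspace_L_iff:
  "\<beta> \<in> topspace L \<longleftrightarrow>
     (\<forall>v. 0 \<le> \<beta> v) \<and> (\<exists>j\<in>I. (\<forall>v. v \<notin> insert (p j) (A j) \<longrightarrow> \<beta> v = 0) \<and>
       card {v \<in> A j. \<beta> v \<noteq> 0} \<le> k \<and> (\<beta> (p j) \<noteq> 0 \<longrightarrow> k < card (A j)) \<and>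
       \<beta> (p j) + sum \<beta> (A j) = 1)"
proof -
  have sum: "(\<Sum>v | \<beta> v \<noteq> 0. \<beta> v) = \<beta> (p j) + sum \<beta> (A j)"
    if "j \<in> I" "{v. \<beta> v \<noteq> 0} \<subseteq> insert (p j) (A j)" for j
  proof -
    have "(\<Sum>v | \<beta> v \<noteq> 0. \<beta> v) = sum \<beta> (insert (p j) (A j))"
      using that finite_A by (intro sum.mono_neutral_left) auto
    then show ?thesis using that finite_A p_notin_A by simp
  qed
  have ne: "{v. \<beta> v \<noteq> 0} \<noteq> {}" if "\<beta> (p j) + sum \<beta> (A j) = 1" for j
  proof
    assume "{v. \<beta> v \<noteq> 0} = {}"
    then have "\<beta> v = 0" for v by blast
    then show False using that by simp
  qed
  have supp: "{v. \<beta> v \<noteq> 0} \<subseteq> insert (p j) (A j)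
      \<longleftrightarrow> (\<forall>v. v \<notin> insert (p j) (A j) \<longrightarrow> \<beta> v = 0)" for j by blast
  have Int: "{v. \<beta> v \<noteq> 0} \<inter> A j = {v \<in> A j. \<beta> v \<noteq> 0}" for j by blast
  show ?thesis
  proof (rule iffI)
    assume "(\<forall>v. 0 \<le> \<beta> v) \<and> (\<exists>j\<in>I. (\<forall>v. v \<notin> insert (p j) (A j) \<longrightarrow> \<beta> v = 0) \<and>
       card {v \<in> A j. \<beta> v \<noteq> 0} \<le> k \<and> (\<beta> (p j) \<noteq> 0 \<longrightarrow> k < card (A j)) \<and>
       \<beta> (p j) + sum \<beta> (A j) = 1)"
    then obtain j where "j \<in> I" "\<forall>v. 0 \<le> \<beta> v" "\<forall>v. v \<notin> insert (p j) (A j) \<longrightarrow> \<beta> v = 0"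
      "card {v \<in> A j. \<beta> v \<noteq> 0} \<le> k" "\<beta> (p j) \<noteq> 0 \<longrightarrow> k < card (A j)"
      "\<beta> (p j) + sum \<beta> (A j) = 1"
      by blast
    then show "\<beta> \<in> topspace L"
      unfolding topspace_realization_iff coned_complex_def mem_Collect_eq Int[symmetric]
        supp[symmetric]
      using sum[of j] ne[of j] by (intro conjI bexI[of _ j]) simp_all
  next
    assume "\<beta> \<in> topspace L"
    then obtain j where j: "j \<in> I" "{v. \<beta> v \<noteq> 0} \<subseteq> insert (p j) (A j)"
      "card ({v. \<beta> v \<noteq> 0} \<inter> A j) \<le> k" "p j \<in> {v. \<beta> v \<noteq> 0} \<longrightarrow> k < card (A j)"
      "(\<Sum>v | \<beta> v \<noteq> 0. \<beta> v) = 1" "\<forall>v. 0 \<le> \<beta> v"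
      unfolding topspace_realization_iff coned_complex_def by blast
    moreover have "\<beta> (p j) + sum \<beta> (A j) = 1" using sum[OF j(1,2)] j(5) by simp
    ultimately show "(\<forall>v. 0 \<le> \<beta> v) \<and> (\<exists>j\<in>I. (\<forall>v. v \<notin> insert (p j) (A j) \<longrightarrow> \<beta> v = 0) \<and>
       card {v \<in> A j. \<beta> v \<noteq> 0} \<le> k \<and> (\<beta> (p j) \<noteq> 0 \<longrightarrow> k < card (A j)) \<and>
       \<beta> (p j) + sum \<beta> (A j) = 1)"
      unfolding Int supp mem_Collect_eq by (intro conjI bexI[of _ j])
  qed
qed

lemma p_eq_iff: "i \<in> I \<Longrightarrow> j \<in> I \<Longrightarrow> p i = p j \<longleftrightarrow> i = j"
  using inj_p by (auto simp: inj_on_def)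

text \<open>The mass at \<open>v\<close> that facet \<open>i\<close> gives up to its apex. What
  remains of a nonnegative coordinate is its part above the level.\<close>

definition excess :: "'i \<Rightarrow> ('v \<Rightarrow> real) \<Rightarrow> 'v \<Rightarrow> real" where
  "excess i \<alpha> v = (if v \<in> A i then min (\<alpha> v) (order_level k (A i) \<alpha>) else 0)"

text \<open>\<open>push\<close> cuts every coordinate down by the level of its facet and moves the mass so removed to the
  apex; \<open>pull\<close> sends the apex to the barycentre of the facet. Then \<open>push \<circ> pull\<close> is the identity,
  and \<open>pull \<circ> push\<close> moves each point within its facet.\<close>

definition push :: "('v \<Rightarrow> real) \<Rightarrow> 'v \<Rightarrow> real" where
  "push \<alpha> v = \<alpha> v - (\<Sum>i\<in>I. excess i \<alpha> v)
     + (\<Sum>i\<in>I. if v = p i then sum (excess i \<alpha>) (A i) else 0)"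

definition pull :: "('v \<Rightarrow> real) \<Rightarrow> 'v \<Rightarrow> real" where
  "pull \<beta> v = (if v \<in> (\<Union>i\<in>I. A i) then \<beta> v else 0)
     + (\<Sum>i\<in>I. if v \<in> A i then \<beta> (p i) / card (A i) else 0)"

lemma continuous_on_excess: "i \<in> I \<Longrightarrow> continuous_on D (\<lambda>\<alpha>. excess i \<alpha> v)"
  unfolding excess_def
  by (cases "v \<in> A i")
    (auto intro!: continuous_on_min continuous_on_coordinate continuous_on_order_level finite_A)

lemma continuous_on_push: "continuous_on D push"
proof (rule continuous_on_coordinatewise_then_product)
  have "continuous_on D (\<lambda>\<alpha>. if v = p i then sum (excess i \<alpha>) (A i) else 0)" if "i \<in> I" for i v
    using that by (cases "v = p i") (auto intro!: continuous_on_sum continuous_on_excess)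
  then show "continuous_on D (\<lambda>\<alpha>. push \<alpha> v)" for v
    unfolding push_def
    by (intro continuous_intros continuous_on_coordinate continuous_on_excess)
qed

lemma continuous_on_pull: "continuous_on D pull"
proof (rule continuous_on_coordinatewise_then_product)
  have "continuous_on D (\<lambda>\<beta>. if v \<in> A i then \<beta> (p i) / card (A i) else 0)" for i v
    by (cases "v \<in> A i") (simp_all add: divide_inverse continuous_on_mult_right continuous_on_coordinate)
  moreover have "continuous_on D (\<lambda>\<beta>::'v \<Rightarrow> real. if v \<in> (\<Union>i\<in>I. A i) then \<beta> v else 0)" for v
    by (cases "v \<in> (\<Union>i\<in>I. A i)") (auto intro!: continuous_on_coordinate)
  ultimately show "continuous_on D (\<lambda>\<beta>. pull \<beta> v)" for v
    unfolding pull_def by (intro continuous_intros)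
qed

text \<open>On a facet, only that facet's own level is nonzero, since the other facets meet it in at
  most \<open>k\<close> vertices.\<close>

lemma push_on_facet:
  assumes j: "j \<in> I" and nonneg: "\<forall>v. 0 \<le> \<alpha> v" and supp: "\<forall>v. v \<notin> A j \<longrightarrow> \<alpha> v = 0"
  shows "push \<alpha> v = \<alpha> v - excess j \<alpha> v + (if v = p j then sum (excess j \<alpha>) (A j) else 0)"
proof -
  have zero: "excess i \<alpha> u = 0" if "i \<in> I" "i \<noteq> j" for i u
  proof -
    have "card {v \<in> A i. \<alpha> v \<noteq> 0} \<le> card (A i \<inter> A j)"
      using supp finite_A that(1) by (intro card_mono) auto
    also have "\<dots> \<le> k" using card_Int_le that j by simp
    finally have "order_level k (A i) \<alpha> = 0"
      using nonneg finite_A that(1) by (intro order_level_eq_0) auto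
    then show ?thesis using nonneg[rule_format, of u] by (simp add: excess_def)
  qed
  have "(\<Sum>i\<in>I. excess i \<alpha> v) = excess j \<alpha> v"
    using sum.remove[OF finite_I j, of "\<lambda>i. excess i \<alpha> v"] zero by simp
  moreover have "(\<Sum>i\<in>I. if v = p i then sum (excess i \<alpha>) (A i) else 0)
      = (if v = p j then sum (excess j \<alpha>) (A j) else 0)"
    using sum.remove[OF finite_I j, of "\<lambda>i. if v = p i then sum (excess i \<alpha>) (A i) else 0"] zero
    by (simp cong: if_cong)
  ultimately show ?thesis by (simp add: push_def)
qed

lemma pull_on_cone:
  assumes j: "j \<in> I" and supp: "\<forall>v. v \<notin> insert (p j) (A j) \<longrightarrow> \<beta> v = 0"
  shows "pull \<beta> v = (if v \<in> A j then \<beta> v + \<beta> (p j) / card (A j) else 0)"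
proof -
  have "\<beta> (p i) = 0" if "i \<in> I" "i \<noteq> j" for i
    using that j p_eq_iff p_notin_A by (intro supp[rule_format]) auto
  then have "(\<Sum>i\<in>I. if v \<in> A i then \<beta> (p i) / card (A i) else 0)
      = (if v \<in> A j then \<beta> (p j) / card (A j) else 0)"
    using sum.remove[OF finite_I j, of "\<lambda>i. if v \<in> A i then \<beta> (p i) / card (A i) else 0"]
    by (simp cong: if_cong)
  moreover have "(if v \<in> (\<Union>i\<in>I. A i) then \<beta> v else 0) = (if v \<in> A j then \<beta> v else 0)"
    using j p_notin_A supp[rule_format, of v] by auto
  ultimately show ?thesis by (simp add: pull_def)
qed

lemma push_carrier:
  assumes j: "j \<in> I" and nonneg: "\<forall>v. 0 \<le> \<alpha> v" and supp: "\<forall>v. v \<notin> A j \<longrightarrow> \<alpha> v = 0"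
    and sum1: "sum \<alpha> (A j) = 1"
  shows "\<forall>v. 0 \<le> push \<alpha> v"
    and "\<forall>v. v \<notin> insert (p j) (A j) \<longrightarrow> push \<alpha> v = 0"
    and "card {v \<in> A j. push \<alpha> v \<noteq> 0} \<le> k"
    and "push \<alpha> (p j) \<noteq> 0 \<longrightarrow> k < card (A j)"
    and "push \<alpha> (p j) + sum (push \<alpha>) (A j) = 1"
proof -
  note push = push_on_facet[OF j nonneg supp]
  have fin: "finite (A j)" using finite_A j by simp
  have pj: "p j \<notin> A j" using p_notin_A j by simp
  have level: "0 \<le> order_level k (A j) \<alpha>" using order_level_nonneg fin nonneg by blast
  have ex: "0 \<le> excess j \<alpha> v" "excess j \<alpha> v \<le> \<alpha> v" for v
    using level nonneg[rule_format, of v] by (auto simp: excess_def)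
  have push_A: "push \<alpha> v = \<alpha> v - excess j \<alpha> v" if "v \<in> A j" for v
    using that pj by (auto simp: push)
  have push_p: "push \<alpha> (p j) = sum (excess j \<alpha>) (A j)"
    using pj supp[rule_format, OF pj] by (simp add: push excess_def)
  show "\<forall>v. 0 \<le> push \<alpha> v" using ex by (auto simp: push intro!: add_nonneg_nonneg sum_nonneg)
  show "\<forall>v. v \<notin> insert (p j) (A j) \<longrightarrow> push \<alpha> v = 0"
    using supp by (auto simp: push excess_def)
  \<comment> \<open>Cutting at the level leaves exactly the vertices strictly above it.\<close>
  have "{v \<in> A j. push \<alpha> v \<noteq> 0} = {v \<in> A j. order_level k (A j) \<alpha> < \<alpha> v}"
    by (auto simp: push_A excess_def min_def split: if_splits)
  then show "card {v \<in> A j. push \<alpha> v \<noteq> 0} \<le> k"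
    using card_above_order_level fin by simp
  show "push \<alpha> (p j) \<noteq> 0 \<longrightarrow> k < card (A j)"
  proof (rule impI, rule ccontr)
    \<comment> \<open>On a facet with at most \<open>k\<close> vertices the level is 0 by
      definition, so no mass reaches its apex.\<close>
    assume "push \<alpha> (p j) \<noteq> 0" "\<not> k < card (A j)"
    then have "excess j \<alpha> v = 0" for v
      using nonneg[rule_format, of v] by (simp add: excess_def order_level_def)
    then show False using \<open>push \<alpha> (p j) \<noteq> 0\<close> push_p by simp
  qed
  have "sum (push \<alpha>) (A j) = sum \<alpha> (A j) - sum (excess j \<alpha>) (A j)"
    using push_A by (simp add: sum_subtractf)
  then show "push \<alpha> (p j) + sum (push \<alpha>) (A j) = 1" using push_p sum1 by simp
qed

lemma pull_carrier:
  assumes j: "j \<in> I" and nonneg: "\<forall>v. 0 \<le> \<beta> v"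
    and supp: "\<forall>v. v \<notin> insert (p j) (A j) \<longrightarrow> \<beta> v = 0"
    and apex: "\<beta> (p j) \<noteq> 0 \<longrightarrow> k < card (A j)"
    and sum1: "\<beta> (p j) + sum \<beta> (A j) = 1"
  shows "\<forall>v. 0 \<le> pull \<beta> v"
    and "\<forall>v. v \<notin> A j \<longrightarrow> pull \<beta> v = 0"
    and "sum (pull \<beta>) (A j) = 1"
proof -
  note pull = pull_on_cone[OF j supp]
  show "\<forall>v. 0 \<le> pull \<beta> v" using nonneg by (auto simp: pull)
  show "\<forall>v. v \<notin> A j \<longrightarrow> pull \<beta> v = 0" by (simp add: pull)
  have "sum (pull \<beta>) (A j) = sum \<beta> (A j) + card (A j) * (\<beta> (p j) / card (A j))"
    by (simp add: pull sum.distrib)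
  \<comment> \<open>A nonzero apex coordinate occurs only on a facet with more than \<open>k\<close>
    vertices, so the division is never by 0 when it matters.\<close>
  also have "card (A j) * (\<beta> (p j) / card (A j)) = \<beta> (p j)"
    using apex by (cases "\<beta> (p j) = 0") auto
  finally show "sum (pull \<beta>) (A j) = 1" using sum1 by simp
qed

text \<open>\<open>pull\<close> spreads the apex coordinate evenly over the facet. As \<beta> is
  supported on at most \<open>k\<close> vertices there, that even share is exactly the level of the
  new point, so \<open>push\<close> collects precisely what was spread.\<close>

lemma push_pull:
  assumes "\<beta> \<in> topspace L"
  shows "push (pull \<beta>) = \<beta>"
proof -
  from assms obtain j where j: "j \<in> I" and nonneg: "\<forall>v. 0 \<le> \<beta> v"
    and supp: "\<forall>v. v \<notin> insert (p j) (A j) \<longrightarrow> \<beta> v = 0"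
    and small: "card {v \<in> A j. \<beta> v \<noteq> 0} \<le> k"
    and apex: "\<beta> (p j) \<noteq> 0 \<longrightarrow> k < card (A j)"
    and sum1: "\<beta> (p j) + sum \<beta> (A j) = 1"
    unfolding topspace_L_iff by blast
  note pull = pull_on_cone[OF j supp]
  note carrier = pull_carrier[OF j nonneg supp apex sum1]
  have fin: "finite (A j)" using finite_A j by simp
  have pj: "p j \<notin> A j" using p_notin_A j by simp
  let ?s = "\<beta> (p j) / card (A j)"
  have level: "order_level k (A j) (pull \<beta>) = ?s"
  proof (cases "k < card (A j)")
    case True
    show ?thesis
      by (rule order_level_const_off_small_set[OF fin True _ small])
        (use nonneg in \<open>auto simp: pull\<close>)
  next
    case False
    then show ?thesis using apex by (auto simp: order_level_def)
  qed
  have excess: "excess j (pull \<beta>) v = (if v \<in> A j then ?s else 0)" for v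
    using nonneg[rule_format, of v] by (simp add: excess_def level pull)
  have "sum (excess j (pull \<beta>)) (A j) = card (A j) * ?s"
    by (simp add: excess)
  also have "\<dots> = \<beta> (p j)"
    using apex by (cases "\<beta> (p j) = 0") auto
  finally have sum_excess: "sum (excess j (pull \<beta>)) (A j) = \<beta> (p j)" .
  show ?thesis
  proof
    fix v
    have "push (pull \<beta>) v = pull \<beta> v - excess j (pull \<beta>) v + (if v = p j then \<beta> (p j) else 0)"
      using push_on_facet[OF j, of "pull \<beta>" v] carrier sum_excess by simp
    then show "push (pull \<beta>) v = \<beta> v"
      using pj supp[rule_format, of v] by (auto simp: pull excess)
  qed
qed

lemma push_image: "push \<in> topspace K \<rightarrow> topspace L"
proof
  fix \<alpha> assume "\<alpha> \<in> topspace K"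
  then obtain j where "j \<in> I" "\<forall>v. 0 \<le> \<alpha> v" "\<forall>v. v \<notin> A j \<longrightarrow> \<alpha> v = 0" "sum \<alpha> (A j) = 1"
    unfolding topspace_K_iff by blast
  then show "push \<alpha> \<in> topspace L"
    unfolding topspace_L_iff using push_carrier[of j \<alpha>] by blast
qed

lemma pull_image: "pull \<in> topspace L \<rightarrow> topspace K"
proof
  fix \<beta> assume "\<beta> \<in> topspace L"
  then obtain j where "j \<in> I" "\<forall>v. 0 \<le> \<beta> v" "\<forall>v. v \<notin> insert (p j) (A j) \<longrightarrow> \<beta> v = 0"
    "\<beta> (p j) \<noteq> 0 \<longrightarrow> k < card (A j)" "\<beta> (p j) + sum \<beta> (A j) = 1"
    unfolding topspace_L_iff by blast
  then show "pull \<beta> \<in> topspace K"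
    unfolding topspace_K_iff using pull_carrier[of j \<beta>] by blast
qed

text \<open>A point and its image lie in a common facet, whose realization is convex, so the
  straight segment between them stays in the complex.\<close>

lemma homotopic_pull_push: "homotopic_with (\<lambda>_. True) K K (pull \<circ> push) id"
proof -
  let ?h = "\<lambda>(t, \<alpha>) v. (1 - t) * pull (push \<alpha>) v + t * \<alpha> v"
  have K_eq: "K = top_of_set (topspace K)" by (simp add: realization_def)
  have cont: "continuous_on ({0..1} \<times> topspace K) ?h"
  proof (rule continuous_on_coordinatewise_then_product)
    fix v
    have "continuous_on UNIV (\<lambda>\<alpha>. pull (push \<alpha>) v)"
      by (rule continuous_on_product_then_coordinatewise[of UNIV "\<lambda>\<alpha>. pull (push \<alpha>)"])
        (rule continuous_on_compose2[OF continuous_on_pull continuous_on_push subset_UNIV])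
    then have "continuous_on ({0..1} \<times> topspace K) (\<lambda>x. pull (push (snd x)) v)"
      by (rule continuous_on_compose2[OF _ continuous_on_snd[OF continuous_on_id]]) simp
    moreover have "continuous_on ({0..1} \<times> topspace K) (\<lambda>x. snd x v)"
      by (rule continuous_on_compose2[OF continuous_on_coordinate[of UNIV v]
            continuous_on_snd[OF continuous_on_id]]) simp
    ultimately show "continuous_on ({0..1} \<times> topspace K) (\<lambda>x. ?h x v)"
      unfolding case_prod_beta
      by (intro continuous_on_add continuous_on_mult continuous_on_diff continuous_on_const
          continuous_on_fst[OF continuous_on_id])
  qed
  have "?h (t, \<alpha>) \<in> topspace K" if t: "t \<in> {0..1}" and "\<alpha> \<in> topspace K" for t \<alpha>
  proof -
    obtain j where j: "j \<in> I" and \<alpha>: "\<forall>v. 0 \<le> \<alpha> v" "\<forall>v. v \<notin> A j \<longrightarrow> \<alpha> v = 0" "sum \<alpha> (A j) = 1"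
      using \<open>\<alpha> \<in> topspace K\<close> unfolding topspace_K_iff by blast
    note push = push_carrier[OF j \<alpha>]
    note pull = pull_carrier[OF j push(1,2,4,5)]
    have "sum (?h (t, \<alpha>)) (A j) = 1"
      using \<alpha>(3) pull(3) by (simp add: sum.distrib flip: sum_distrib_left)
    moreover have "\<forall>v. 0 \<le> ?h (t, \<alpha>) v" using t \<alpha>(1) pull(1) by simp
    moreover have "\<forall>v. v \<notin> A j \<longrightarrow> ?h (t, \<alpha>) v = 0" using \<alpha>(2) pull(2) by simp
    ultimately show ?thesis unfolding topspace_K_iff using j by blast
  qed
  then have "?h \<in> {0..1} \<times> topspace K \<rightarrow> topspace K" by blast
  with cont have "continuous_map (prod_topology (top_of_set {0..1}) K) K ?h"
    by (subst (1 2) K_eq) (simp only: prod_topology_subtopology_eu continuous_map_subtopology_eu)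
  then show ?thesis
    unfolding homotopic_with_def by (intro exI[of _ ?h]) auto
qed

theorem homotopy_equivalent_coned_complex: "K homotopy_equivalent_space L"
  unfolding homotopy_equivalent_space_def
proof (intro exI conjI)
  have eq: "realization M = top_of_set (topspace (realization M))" for M :: "'v set set"
    by (simp add: realization_def)
  show "continuous_map K L push"
    by (subst (1 2) eq) (simp only: continuous_map_subtopology_eu continuous_on_push push_image simp_thms)
  show "continuous_map L K pull"
    by (subst (1 2) eq) (simp only: continuous_map_subtopology_eu continuous_on_pull pull_image simp_thms)
  then have "continuous_map L L (push \<circ> pull)"
    using \<open>continuous_map K L push\<close> by (rule continuous_map_compose)
  then show "homotopic_with (\<lambda>_. True) L L (push \<circ> pull) id"
    by (intro homotopic_with_equal) (auto simp: push_pull)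
  show "homotopic_with (\<lambda>_. True) K K (pull \<circ> push) id"
    by (rule homotopic_pull_push)
qed

lemma finite_coned_complex: "finite (coned_complex k I A p)"
proof (rule finite_subset)
  show "coned_complex k I A p \<subseteq> (\<Union>i\<in>I. Pow (insert (p i) (A i)))"
    by (auto simp: coned_complex_def)
  show "finite (\<Union>i\<in>I. Pow (insert (p i) (A i)))"
    using finite_I finite_A by auto
qed

lemma coned_complex_simplex:
  assumes "S \<in> coned_complex k I A p"
  shows "finite S \<and> S \<noteq> {} \<and> card S \<le> Suc k"
proof -
  obtain i where i: "i \<in> I" "S \<subseteq> insert (p i) (A i)" "card (S \<inter> A i) \<le> k" "S \<noteq> {}"
    using assms by (auto simp: coned_complex_def)
  have "finite S" using i(1,2) finite_A finite_subset by blast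
  moreover have "card S \<le> card (insert (p i) (S \<inter> A i))"
    using i(2) \<open>finite S\<close> by (intro card_mono) auto
  then have "card S \<le> Suc k"
    using i(3) card_insert_le_m1[of "Suc k" "S \<inter> A i" "p i"] by simp
  ultimately show ?thesis using i(4) by blast
qed

lemma coned_complex_subset:
  assumes "S \<in> coned_complex k I A p" "T \<subseteq> S" "T \<noteq> {}"
  shows "T \<in> coned_complex k I A p"
proof -
  obtain i where i: "i \<in> I" "S \<subseteq> insert (p i) (A i)" "card (S \<inter> A i) \<le> k"
    "p i \<in> S \<longrightarrow> k < card (A i)"
    using assms(1) by (auto simp: coned_complex_def)
  have "card (T \<inter> A i) \<le> card (S \<inter> A i)"
    using assms(2) i(1) finite_A by (intro card_mono) auto
  then show ?thesis
    unfolding coned_complex_def using i assms(2,3) by force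
qed

end

section \<open>Transfers of partitions\<close>

lemma row_eq_0: "length l \<le> i \<Longrightarrow> row l i = 0"
  by (simp add: row_def)

lemma row_injective:
  assumes "\<forall>x\<in>set l. 0 < x" "\<forall>x\<in>set m. 0 < x" "row l = row m"
  shows "l = m"
proof -
  have "\<not> length u < length v" if "\<forall>x\<in>set v. 0 < x" "row u = row v" for u v
  proof
    assume "length u < length v"
    then have "row v (length u) > 0" using that(1) by (simp add: row_def)
    then show False using that(2) by (metis less_irrefl order_refl row_eq_0)
  qed
  then have "length l = length m" using assms by (metis nat_neq_iff)
  moreover have "l ! i = m ! i" if "i < length l" for i
    using fun_cong[OF assms(3), of i] that \<open>length l = length m\<close> by (simp add: row_def)
  ultimately show ?thesis by (rule nth_equalityI)
qed

lemma partition_injective: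
  "is_partition n l \<Longrightarrow> is_partition n m \<Longrightarrow> row l = row m \<Longrightarrow> l = m"
  by (auto simp: is_partition_def intro: row_injective)

lemma antimono_iff: "antimono f \<longleftrightarrow> (\<forall>i. f (Suc i) \<le> f i)" for f :: "nat \<Rightarrow> nat"
  by (auto simp: antimono_iff_le_Suc)

lemma antimono_row: "is_partition n l \<Longrightarrow> antimono (row l)"
  unfolding antimono_iff is_partition_def row_def by (auto simp: sorted_wrt_iff_nth_less)

text \<open>The positive values form an initial segment, so the filter truncates and shifts no
  index.\<close>

lemma filter_pos_antimono:
  fixes g :: "nat \<Rightarrow> nat"
  assumes "antimono g" "\<forall>i\<ge>N. g i = 0"
  shows "row (filter (\<lambda>x. 0 < x) (map g [0..<N])) = g"
    and "sorted_wrt (\<ge>) (filter (\<lambda>x. 0 < x) (map g [0..<N]))"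
proof -
  define m where "m = (LEAST i. g i = 0)"
  have "g m = 0" unfolding m_def using assms(2) by (rule_tac LeastI[of _ N]) auto
  then have zero: "g i = 0" if "m \<le> i" for i using assms(1) that by (metis antimonoD le_zero_eq)
  have pos: "0 < g i" if "i < m" for i using that not_less_Least[of i] unfolding m_def by blast
  have "m \<le> N" unfolding m_def using assms(2) by (intro Least_le) auto
  then have "[0..<N] = [0..<m] @ [m..<N]" by (metis upt_add_eq_append zero_le le_add_diff_inverse)
  moreover have "filter (\<lambda>x. 0 < x) (map g [0..<m]) = map g [0..<m]"
    using pos by (auto simp: filter_id_conv)
  moreover have "filter (\<lambda>x. 0 < x) (map g [m..<N]) = []"
    using zero by (auto simp: filter_empty_conv)
  ultimately have eq: "filter (\<lambda>x. 0 < x) (map g [0..<N]) = map g [0..<m]" by simp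
  show "row (filter (\<lambda>x. 0 < x) (map g [0..<N])) = g"
    unfolding eq using zero by (auto simp: row_def fun_eq_iff)
  show "sorted_wrt (\<ge>) (filter (\<lambda>x. 0 < x) (map g [0..<N]))"
    unfolding eq using assms(1) by (auto simp: sorted_wrt_iff_nth_less antimonoD)
qed

text \<open>Sorting depends on the multiset alone. This is used with \<open>g = f\<close>, when a
  transfer is already in order, and with \<open>g\<close> the original rows, when it merely permutes
  them.\<close>

lemma row_sorted_values:
  fixes f g :: "nat \<Rightarrow> nat"
  assumes "antimono g" "\<forall>i\<ge>N. g i = 0" "mset (map f [0..<N]) = mset (map g [0..<N])"
  shows "row (rev (sort (filter (\<lambda>x. 0 < x) (map f [0..<N])))) = g"
proof -
  have "sort (filter (\<lambda>x. 0 < x) (map f [0..<N])) = rev (filter (\<lambda>x. 0 < x) (map g [0..<N]))"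
  proof (rule properties_for_sort)
    show "mset (rev (filter (\<lambda>x. 0 < x) (map g [0..<N])))
        = mset (filter (\<lambda>x. 0 < x) (map f [0..<N]))"
      unfolding mset_rev mset_filter assms(3) ..
    show "sorted (rev (filter (\<lambda>x. 0 < x) (map g [0..<N])))"
      unfolding sorted_wrt_rev by (rule filter_pos_antimono(2)[OF assms(1,2)])
  qed
  then show ?thesis using filter_pos_antimono(1)[OF assms(1,2)] by simp
qed

lemma sum_list_filter_pos: "sum_list (filter (\<lambda>x. 0 < x) xs) = sum_list xs" for xs :: "nat list"
  by (induction xs) auto

lemma removable_less_length: "c \<in> removable l \<Longrightarrow> c < length l"
  by (rule ccontr) (simp add: removable_def row_eq_0)

lemma addable_le_length:
  assumes "a \<in> addable l"
  shows "a \<le> length l"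
proof (rule ccontr)
  assume "\<not> a \<le> length l"
  then have "0 < a" "length l \<le> a - 1" by auto
  moreover have "((row l)(a := row l a + 1)) a \<le> ((row l)(a := row l a + 1)) (a - 1)"
    using assms unfolding addable_def mem_Collect_eq by (rule antimonoD) simp
  moreover have "row l (a - 1) = 0" using \<open>length l \<le> a - 1\<close> by (rule row_eq_0)
  moreover have "a - 1 \<noteq> a" using \<open>0 < a\<close> by simp
  ultimately show False by simp
qed

abbreviation transfer_rows :: "nat list \<Rightarrow> nat \<Rightarrow> nat \<Rightarrow> nat \<Rightarrow> nat" where
  "transfer_rows l c a \<equiv> (row l)(c := row l c - 1, a := row l a + 1)"

context
  fixes n :: nat and l :: "nat list" and c a :: nat
  assumes l: "is_partition n l" and c: "c \<in> removable l" and a: "a \<in> addable l" and ca: "c \<noteq> a"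
begin

lemma row_transfer:
  assumes "antimono (transfer_rows l c a)"
  shows "row (transfer l c a) = transfer_rows l c a"
  unfolding transfer_def
proof (rule row_sorted_values[OF assms _ refl])
  show "\<forall>i\<ge>Suc (length l). transfer_rows l c a i = 0"
    using removable_less_length[OF c] addable_le_length[OF a] by (simp add: row_eq_0)
qed

lemma transfer_pos: "\<forall>x\<in>set (transfer l c a). 0 < x"
  by (auto simp: transfer_def)

text \<open>A failure of monotonicity can only sit between rows \<open>c\<close> and
  \<open>a = Suc c\<close>, with lengths that differ by 1. Moving the cell exchanges these two
  lengths, and sorting undoes the exchange.\<close>

lemma transfer_eq_self:
  assumes "\<not> antimono (transfer_rows l c a)"
  shows "transfer l c a = l"
proof (rule row_injective[OF transfer_pos])
  show "\<forall>x\<in>set l. 0 < x" using l by (simp add: is_partition_def)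
  let ?f = "transfer_rows l c a" and ?N = "Suc (length l)"
  have mono: "row l (Suc i) \<le> row l i" for i
    using antimono_row[OF l] by (simp add: antimono_iff)
  have add: "((row l)(a := row l a + 1)) (Suc i) \<le> ((row l)(a := row l a + 1)) i" for i
    using a by (simp add: addable_def antimono_iff)
  have rem: "row l (Suc c) < row l c" using c by (simp add: removable_def)
  obtain i where i: "?f i < ?f (Suc i)" using assms by (auto simp: antimono_iff not_le)
  have "i = c \<and> Suc i = a"
    using i mono[of i] add[of i] rem ca by (auto split: if_splits)
  then have swap: "row l c - 1 = row l a" "row l a + 1 = row l c"
    using i rem by auto
  have "map ?f [0..<?N] = (map (row l) [0..<?N])
      [a := map (row l) [0..<?N] ! c, c := map (row l) [0..<?N] ! a]"
    using removable_less_length[OF c] addable_le_length[OF a] swap ca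
    by (intro nth_equalityI) (auto simp: nth_list_update simp del: upt_Suc)
  then have "mset (map ?f [0..<?N]) = mset (map (row l) [0..<?N])"
    using removable_less_length[OF c] addable_le_length[OF a]
    by (simp only:) (subst mset_swap, simp_all)
  then show "row (transfer l c a) = row l"
    unfolding transfer_def by (intro row_sorted_values antimono_row[OF l]) (simp_all add: row_eq_0)
qed

lemma is_partition_transfer: "is_partition n (transfer l c a)"
proof -
  let ?f = "transfer_rows l c a" and ?N = "Suc (length l)"
  have "mset (transfer l c a) = mset (filter (\<lambda>x. 0 < x) (map ?f [0..<?N]))"
    unfolding transfer_def mset_rev mset_sort ..
  then have "sum_list (transfer l c a) = sum_list (filter (\<lambda>x. 0 < x) (map ?f [0..<?N]))"
    by (metis sum_mset_sum_list)
  also have "\<dots> = sum ?f {0..<?N}"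
    unfolding sum_list_filter_pos interv_sum_list_conv_sum_set_nat set_upt ..
  also have "\<dots> = sum (row l) {0..<?N}"
  proof -
    have in_N: "c \<in> {0..<?N}" "a \<in> {0..<?N} - {c}"
      using removable_less_length[OF c] addable_le_length[OF a] ca by auto
    have split: "sum h {0..<?N} = h c + (h a + sum h ({0..<?N} - {c} - {a}))" for h :: "nat \<Rightarrow> nat"
      using sum.remove[OF _ in_N(1), of h] sum.remove[OF _ in_N(2), of h] by simp
    have "sum ?f ({0..<?N} - {c} - {a}) = sum (row l) ({0..<?N} - {c} - {a})"
      by (intro sum.cong) auto
    moreover have "0 < row l c" using c by (auto simp: removable_def)
    ultimately show ?thesis using ca unfolding split[of ?f] split[of "row l"] by simp
  qed
  also have "\<dots> = sum_list (map (row l) [0..<length l])"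
    unfolding interv_sum_list_conv_sum_set_nat set_upt by (simp add: row_eq_0)
  also have "map (row l) [0..<length l] = l" by (rule nth_equalityI) (auto simp: row_def)
  also have "sum_list l = n" using l by (simp add: is_partition_def)
  finally have "sum_list (transfer l c a) = n" .
  moreover have "sorted_wrt (\<ge>) (transfer l c a)"
    unfolding transfer_def by (simp add: sorted_wrt_rev)
  ultimately show ?thesis using transfer_pos by (simp add: is_partition_def)
qed

text \<open>Whenever reordering has something to do it restores \<open>l\<close>, so asking for a
  result different from \<open>l\<close> amounts to asking that no reordering be needed.\<close>

lemma admissible_iff: "admissible n l c a \<longleftrightarrow> antimono (transfer_rows l c a)"
proof
  assume "antimono (transfer_rows l c a)"
  then have "row (transfer l c a) a = row l a + 1" by (simp add: row_transfer)
  then have "transfer l c a \<noteq> l" by auto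
  then show "admissible n l c a" by (simp add: admissible_def c a ca is_partition_transfer)
next
  assume "admissible n l c a"
  then show "antimono (transfer_rows l c a)" using transfer_eq_self by (auto simp: admissible_def)
qed

end

section \<open>Full simplices as sets of upper or lower covers in Young's lattice\<close>

definition up_set :: "nat \<Rightarrow> (nat \<Rightarrow> nat) \<Rightarrow> nat list set" where
  "up_set n \<mu> = {l. is_partition n l \<and> (\<exists>a. row l = \<mu>(a := Suc (\<mu> a)))}"

definition down_set :: "nat \<Rightarrow> (nat \<Rightarrow> nat) \<Rightarrow> nat list set" where
  "down_set n \<nu> = {l. is_partition n l \<and> (\<exists>c. (row l)(c := Suc (row l c)) = \<nu>)}"

lemma admissibleD:
  assumes "is_partition n l" "admissible n l c a"
  shows "c \<noteq> a" "is_partition n (transfer l c a)" "row (transfer l c a) = transfer_rows l c a"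
    "c \<in> removable l"
proof -
  have *: "c \<in> removable l" "a \<in> addable l" "c \<noteq> a" using assms(2) by (auto simp: admissible_def)
  then show "c \<noteq> a" "is_partition n (transfer l c a)" "c \<in> removable l"
    using is_partition_transfer[OF assms(1) *] by auto
  show "row (transfer l c a) = transfer_rows l c a"
    using assms(2) by (simp add: admissible_iff[OF assms(1) *] row_transfer[OF assms(1) *])
qed

lemma transfer_eqI:
  assumes "is_partition n l" "c \<in> removable l" "a \<in> addable l" "c \<noteq> a"
    and "is_partition n m" "row m = transfer_rows l c a"
  shows "admissible n l c a" "m = transfer l c a"
proof -
  have anti: "antimono (transfer_rows l c a)" using antimono_row[OF assms(5)] assms(6) by simp
  then show "admissible n l c a" by (simp add: admissible_iff[OF assms(1-4)])
  show "m = transfer l c a"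
    using assms(5) is_partition_transfer[OF assms(1-4)]
    by (rule partition_injective) (simp add: row_transfer[OF assms(1-4) anti] assms(6))
qed

text \<open>Every transfer out of \<open>c\<close> passes through the same smaller partition,
  \<open>l\<close> without the corner \<open>c\<close>; putting the cell back at \<open>c\<close>
  gives \<open>l\<close> itself.\<close>

lemma star_simplex_eq_up_set:
  assumes l: "is_partition n l" and c: "c \<in> removable l"
  shows "star_simplex n l c = up_set n ((row l)(c := row l c - 1))" (is "_ = up_set n ?\<mu>")
proof (intro equalityI subsetI)
  fix m assume "m \<in> star_simplex n l c"
  then consider "m = l" | a where "m = transfer l c a" "admissible n l c a"
    by (auto simp: star_simplex_def)
  then show "m \<in> up_set n ?\<mu>"
  proof cases
    case 1
    then have "row m = ?\<mu>(c := Suc (?\<mu> c))" using c by (auto simp: removable_def fun_eq_iff)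
    then show ?thesis using 1 l unfolding up_set_def by blast
  next
    case 2
    note D = admissibleD[OF l 2(2)]
    have "row m = ?\<mu>(a := Suc (?\<mu> a))" using D(1,3) 2(1) by (simp add: fun_eq_iff)
    then show ?thesis using D(2) 2(1) unfolding up_set_def by blast
  qed
next
  fix m assume "m \<in> up_set n ?\<mu>"
  then obtain a where m: "is_partition n m" "row m = ?\<mu>(a := Suc (?\<mu> a))"
    by (auto simp: up_set_def)
  show "m \<in> star_simplex n l c"
  proof (cases "a = c")
    case True
    then have "row m = row l" using m(2) c by (auto simp: removable_def fun_eq_iff)
    then show ?thesis using partition_injective[OF m(1) l] by (simp add: star_simplex_def)
  next
    case False
    then have row_m: "row m = transfer_rows l c a" using m(2) by (simp add: fun_eq_iff)
    \<comment> \<open>The extra cell in row \<open>a\<close> fits even after row \<open>c\<close>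
      has been shortened, so it fits into \<open>l\<close>.\<close>
    have "((row l)(a := row l a + 1)) (Suc i) \<le> ((row l)(a := row l a + 1)) i" for i
      using antimono_row[OF l] antimono_row[OF m(1)] False unfolding antimono_iff row_m
      by (cases "i = a"; cases "Suc i = a"; cases "i = c") (auto dest!: spec[of _ i])
    then have "a \<in> addable l" by (simp only: addable_def antimono_iff mem_Collect_eq simp_thms)
    then show ?thesis
      using transfer_eqI[OF l c _ not_sym[OF False] m(1) row_m] by (auto simp: star_simplex_def)
  qed
qed

text \<open>Dually, every transfer into \<open>a\<close> passes through the larger partition
  obtained by adding the cell at \<open>a\<close> first.\<close>

lemma top_simplex_eq_down_set:
  assumes l: "is_partition n l" and a: "a \<in> addable l"
  shows "top_simplex n l a = down_set n ((row l)(a := Suc (row l a)))" (is "_ = down_set n ?\<nu>")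
proof (intro equalityI subsetI)
  fix m assume "m \<in> top_simplex n l a"
  then consider "m = l" | c where "m = transfer l c a" "admissible n l c a"
    by (auto simp: top_simplex_def)
  then show "m \<in> down_set n ?\<nu>"
  proof cases
    case 1
    then show ?thesis using l unfolding down_set_def by blast
  next
    case 2
    note D = admissibleD[OF l 2(2)]
    have "(row m)(c := Suc (row m c)) = ?\<nu>"
      using D(1,3,4) 2(1) by (auto simp: fun_eq_iff removable_def)
    then show ?thesis using D(2) 2(1) unfolding down_set_def by blast
  qed
next
  fix m assume "m \<in> down_set n ?\<nu>"
  then obtain c where m: "is_partition n m" "(row m)(c := Suc (row m c)) = ?\<nu>"
    by (auto simp: down_set_def)
  have at: "((row m)(c := Suc (row m c))) i = ?\<nu> i" for i using m(2) by simp
  show "m \<in> top_simplex n l a"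
  proof (cases "c = a")
    case True
    have "row m i = row l i" for i using at[of i] True by (auto split: if_splits)
    then have "row m = row l" by (rule ext)
    then show ?thesis using partition_injective[OF m(1) l] by (simp add: top_simplex_def)
  next
    case False
    have "row m i = transfer_rows l c a i" for i
      using at[of i] False by (auto split: if_splits)
    then have row_m: "row m = transfer_rows l c a" by (rule ext)
    \<comment> \<open>Row \<open>c\<close> of \<open>m\<close> is one shorter than in
      \<open>l\<close>, while the next row is at least as long as in \<open>l\<close>, so
      \<open>l\<close> drops strictly after row \<open>c\<close>.\<close>
    have "row m (Suc c) \<le> row m c" using antimono_row[OF m(1)] by (simp add: antimono_iff)
    then have "row l (Suc c) < row l c"
      using at[of c] at[of "Suc c"] False by (auto split: if_splits)
    then have "c \<in> removable l" by (simp add: removable_def)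
    then show ?thesis
      using transfer_eqI[OF l _ a False m(1) row_m] by (auto simp: top_simplex_def)
  qed
qed

lemma full_simplices_cases:
  assumes "U \<in> full_simplices n"
  obtains \<mu> where "U = up_set n \<mu>" | \<nu> where "U = down_set n \<nu>"
proof -
  from assms consider l c where "is_partition n l" "c \<in> removable l" "U = star_simplex n l c"
    | l a where "is_partition n l" "a \<in> addable l" "U = top_simplex n l a"
    unfolding full_simplices_def by blast
  then show thesis
  proof cases
    case 1
    then show thesis using that(1) star_simplex_eq_up_set by blast
  next
    case 2
    then show thesis using that(2) top_simplex_eq_down_set by blast
  qed
qed

text \<open>Distinct members add their cells to \<mu> in different rows, and the minimum discards
  both cells.\<close>

lemma up_set_determined:
  assumes "x \<in> up_set n \<mu>" "y \<in> up_set n \<mu>" "x \<noteq> y"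
  shows "\<mu> = (\<lambda>i. min (row x i) (row y i))"
proof -
  obtain a b where ab: "row x = \<mu>(a := Suc (\<mu> a))" "row y = \<mu>(b := Suc (\<mu> b))"
    using assms(1,2) by (auto simp: up_set_def)
  have "a \<noteq> b" using ab assms partition_injective by (auto simp: up_set_def)
  then show ?thesis unfolding ab by (auto simp: fun_eq_iff)
qed

text \<open>Distinct members lack cells of \<nu> in different rows, and the maximum restores both
  cells.\<close>

lemma down_set_determined:
  assumes "x \<in> down_set n \<nu>" "y \<in> down_set n \<nu>" "x \<noteq> y"
  shows "\<nu> = (\<lambda>i. max (row x i) (row y i))"
proof -
  obtain a b where ab: "(row x)(a := Suc (row x a)) = \<nu>" "(row y)(b := Suc (row y b)) = \<nu>"
    using assms(1,2) by (auto simp: down_set_def)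
  then have at: "((row x)(a := Suc (row x a))) i = \<nu> i" "((row y)(b := Suc (row y b))) i = \<nu> i" for i
    by simp_all
  have "a \<noteq> b"
  proof
    assume "a = b"
    have "row x i = row y i" for i
      using at[of i] \<open>a = b\<close> by (auto split: if_splits)
    then have "row x = row y" by (rule ext)
    then show False using assms partition_injective by (auto simp: down_set_def)
  qed
  show ?thesis
  proof
    fix i show "\<nu> i = max (row x i) (row y i)"
      using at[of i] \<open>a \<noteq> b\<close> by (auto split: if_splits)
  qed
qed

text \<open>There is one candidate of each of the two kinds; this is the source of the 2 in the
  dimension bound.\<close>

lemma full_simplices_pair:
  assumes "x \<noteq> y"
  shows "card {U \<in> full_simplices n. x \<in> U \<and> y \<in> U} \<le> 2"
proof -
  let ?P = "{up_set n (\<lambda>i. min (row x i) (row y i)), down_set n (\<lambda>i. max (row x i) (row y i))}"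
  have sub: "{U \<in> full_simplices n. x \<in> U \<and> y \<in> U} \<subseteq> ?P"
  proof
    fix U assume "U \<in> {U \<in> full_simplices n. x \<in> U \<and> y \<in> U}"
    then have U: "U \<in> full_simplices n" "x \<in> U" "y \<in> U" by auto
    from U(1) show "U \<in> ?P"
    proof (rule full_simplices_cases)
      fix \<mu> assume "U = up_set n \<mu>"
      then show "U \<in> ?P" using up_set_determined[of x n \<mu> y] U assms by blast
    next
      fix \<nu> assume "U = down_set n \<nu>"
      then show "U \<in> ?P" using down_set_determined[of x n \<nu> y] U assms by blast
    qed
  qed
  have "card {U \<in> full_simplices n. x \<in> U \<and> y \<in> U} \<le> card ?P"
    using sub by (rule card_mono[rotated]) simp
  also have "\<dots> \<le> 2" by (simp add: card_insert_if)
  finally show "card {U \<in> full_simplices n. x \<in> U \<and> y \<in> U} \<le> 2" .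
qed

section \<open>Finiteness of the family, and its nerve as a union of facets\<close>

lemma finite_partitions: "finite {l. is_partition n l}"
proof (rule finite_subset)
  show "{l. is_partition n l} \<subseteq> {l. set l \<subseteq> {..n} \<and> length l \<le> n}"
  proof clarify
    fix l assume l: "is_partition n l"
    have "length l \<le> sum_list l" if "\<forall>x\<in>set l. 0 < x" for l :: "nat list"
      using that by (induction l) auto
    then show "set l \<subseteq> {..n} \<and> length l \<le> n"
      using l member_le_sum_list by (fastforce simp: is_partition_def)
  qed
qed (rule finite_lists_length_le, simp)

lemma full_simplices_subset: "full_simplices n \<subseteq> Pow {l. is_partition n l}"
proof
  fix U assume "U \<in> full_simplices n"
  then show "U \<in> Pow {l. is_partition n l}"
    by (rule full_simplices_cases) (auto simp: up_set_def down_set_def)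
qed

lemma finite_full_simplices: "finite (full_simplices n)"
  using full_simplices_subset finite_partitions by (rule finite_subset[OF _ finite_Pow_iff[THEN iffD2]])

text \<open>A common element of the members of a simplex is the index of a facet that contains it;
  it is a partition of \<open>n\<close> because the family consists of sets of such
  partitions.\<close>

lemma nerve_full_simplices:
  "nerve (full_simplices n) =
     facet_complex {x. is_partition n x} (\<lambda>x. {U \<in> full_simplices n. x \<in> U})" (is "?N = ?F")
proof (intro equalityI subsetI)
  fix S assume "S \<in> ?N"
  then obtain x where S: "S \<subseteq> full_simplices n" "S \<noteq> {}" "\<And>U. U \<in> S \<Longrightarrow> x \<in> U"
    by (auto simp: nerve_def)
  then obtain U where "U \<in> full_simplices n" "x \<in> U" by blast
  then have "is_partition n x" using full_simplices_subset by blast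
  then show "S \<in> ?F" using S by (auto simp: facet_complex_def)
next
  fix S assume "S \<in> ?F"
  then obtain x where S: "S \<subseteq> full_simplices n" "S \<noteq> {}" "x \<in> \<Inter>S"
    by (auto simp: facet_complex_def)
  moreover have "finite S"
    using S(1) finite_full_simplices by (rule finite_subset)
  ultimately show "S \<in> ?N" unfolding nerve_def by blast
qed

text \<open>The cone points must be sets of lists outside the family; since \<open>[]\<close> is not a partition of
  \<open>n \<ge> 1\<close>, the sets \<open>{x, []}\<close> will do.\<close>

lemma facets_full_simplices:
  assumes "n \<ge> 1"
  shows "facets 2 {x. is_partition n x} (\<lambda>x. {U \<in> full_simplices n. x \<in> U}) (\<lambda>x. {x, []})"
proof
  have Nil: "\<not> is_partition n []" using assms by (simp add: is_partition_def)
  show "finite {x. is_partition n x}" by (rule finite_partitions)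
  show "finite {U \<in> full_simplices n. x \<in> U}" for x
    using finite_full_simplices by simp
  show "card ({U \<in> full_simplices n. x \<in> U} \<inter> {U \<in> full_simplices n. y \<in> U}) \<le> 2"
    if "x \<noteq> y" for x y
  proof -
    have "{U \<in> full_simplices n. x \<in> U} \<inter> {U \<in> full_simplices n. y \<in> U}
        = {U \<in> full_simplices n. x \<in> U \<and> y \<in> U}" by blast
    then show ?thesis using full_simplices_pair[OF that, of n] by simp
  qed
  show "inj_on (\<lambda>x. {x, []}) {x. is_partition n x}"
    using Nil by (auto simp: inj_on_def doubleton_eq_iff)
  show "{x, []} \<notin> {U \<in> full_simplices n. y \<in> U}" for x y
    using Nil full_simplices_subset[of n] by blast
qed

theorem theorem5p16:
  fixes n :: nat
  assumes "n \<ge> 1"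
  shows "\<exists>X :: (nat list set \<Rightarrow> real) topology.
           CW_complex_dim_le 2 X \<and>
           realization (nerve (full_simplices n)) homotopy_equivalent_space X"
proof -
  interpret facets 2 "{x. is_partition n x}" "\<lambda>x. {U \<in> full_simplices n. x \<in> U}" "\<lambda>x. {x, []}"
    using assms by (rule facets_full_simplices)
  have "CW_complex_dim_le 2 L"
    by (rule CW_complex_dim_le_realization[OF finite_coned_complex coned_complex_simplex
          coned_complex_subset])
  then show ?thesis
    using homotopy_equivalent_coned_complex unfolding nerve_full_simplices by blast
qed

end
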